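(* Assume $\phi\in C^1([0,\infty))$ is nondecreasing and that $\mu(E)=0$ for every $E\subseteq\mathbb{R}^d$ with $\mathcal{H}^1(E)<\infty$. Let $\ell>0$ and let $\Sigma\in\mathcal{S}_\ell$ satisfy $\mathscr{J}(\Sigma)=\inf_{\Sigma'\in\mathcal{S}_\ell}\mathscr{J}(\Sigma')$. Let $\pi_\Sigma\in\Pi_\Sigma$ and $\nu=(\pi_\Sigma)_\#\mu$. Then there exists a constant $C>0$ such that for every noncut point $\sigma^*\in\Sigma$, $$C\int_\Sigma|\mathcal{B}_{\pi_\Sigma}(\sigma)|\,d\nu(\sigma)\le|\mathcal{B}_{\pi_\Sigma}(\sigma^* )|\,\nu(\{\sigma^*\}).$$ In particular, if $\int_\Sigma|\mathcal{B}_{\pi_\Sigma}(\sigma)|\,d\nu(\sigma)\neq0$, then every noncut point of $\Sigma$ is an atom of $\Sigma$, and $\Sigma$ has only finitely many noncut points.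
   Context: Fix an integer $d\ge 2$, a compactly supported Borel probability measure $\mu$ on $\mathbb{R}^d$, and a function $\phi:[0,\infty)\to\mathbb{R}$ with $\phi(0)=0$. $\phi\in C^1([0,\infty))$ means $\phi$ is continuous on $[0,\infty)$, $\phi'$ is continuous on $(0,\infty)$, and $\lim_{t\to0^+}\phi'(t)$ exists in $\mathbb{R}$ (denoted $\phi'(0)$). $\mathcal{H}^1$ is the Hausdorff $1$-measure. $\mathcal{S}_\ell$ is the set of nonempty compact connected $\Sigma\subseteq\mathbb{R}^d$ with $\mathcal{H}^1(\Sigma)\le\ell$. $\dist(x,\Sigma)=\inf_{\sigma\in\Sigma}|x-\sigma|$ (where $\dist$ denotes Euclidean distance), and $\mathscr{J}(\Sigma)=\int_{\mathbb{R}^d}\phi(\mathrm{dist}(x,\Sigma))\,d\mu(x)$. For nonempty compact $\Sigma$, $\Pi_\Sigma$ is the (nonempty) set of Borel maps $\pi_\Sigma:\mathbb{R}^d\to\Sigma$ with $|x-\pi_\Sigma(x)|=\mathrm{dist}(x,\Sigma)$ for all $x$ (closest-point projections). With $\nu=(\pi_\Sigma)_\#\mu$, let $\{\lambda_\sigma\}$ be the disintegration of $\mu$ by $\pi_\Sigma$: a Borel family of probability measures with $\lambda_\sigma$ concentrated on $\pi_\Sigma^{-1}\{\sigma\}$ and $\mu=\int\lambda_\sigma\,d\nu(\sigma)$. The barycentre field is $$\mathcal{B}_{\pi_\Sigma}(\sigma)=\int_{\pi_\Sigma^{-1}\{\sigma\}}\frac{x-\pi_\Sigma(x)}{|x-\pi_\Sigma(x)|}\phi'(|x-\pi_\Sigma(x)|)\,d\lambda_\sigma(x),$$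 defined for $\nu$-a.e. $\sigma$ (the integrand is taken to be $0$ where $x=\pi_\Sigma(x)$, a $\mu$-null set when $\mu(\Sigma)=0$); $|\mathcal{B}_{\pi_\Sigma}(\sigma^* )|\nu(\{\sigma^*\})$ is $0$ if $\nu(\{\sigma^*\})=0$. A point $\sigma\in\Sigma$ is a noncut point if $\Sigma\setminus\{\sigma\}$ is connected. A point $\sigma\in\Sigma$ is an atom of $\Sigma$ if $\mu(\{x:\mathrm{dist}(x,\Sigma)=|x-\sigma|\})>0$. *)

theory Defs
  imports "HOL-Probability.Probability"
begin

(* Hausdorff 1-measure as an outer measure on all sets, normalised so that segments have their
   length as measure. The covering sets are required to be bounded because diameter is a junk
   value on unbounded sets. Empty sets are allowed, so finite covers are included. *)
definition hausdorff1_delta :: "real \<Rightarrow> 'a::metric_space set \<Rightarrow> ennreal" where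
  "hausdorff1_delta \<delta> E =
     (INF U \<in> {U :: nat \<Rightarrow> 'a set. E \<subseteq> (\<Union>i. U i) \<and> (\<forall>i. bounded (U i) \<and> diameter (U i) \<le> \<delta>)}.
        \<Sum>i. ennreal (diameter (U i)))"

definition hausdorff1 :: "'a::metric_space set \<Rightarrow> ennreal" where
  "hausdorff1 E = (SUP \<delta>\<in>{0<..}. hausdorff1_delta \<delta> E)"

definition msupport :: "'a::topological_space measure \<Rightarrow> 'a set" where
  "msupport \<mu> = {x. \<forall>U. open U \<and> x \<in> U \<longrightarrow> emeasure \<mu> U > 0}"

(* A function on the half-line is represented by a total function on the reals. Only its values
   on {0..} are used. *)
definition C1_halfline :: "(real \<Rightarrow> real) \<Rightarrow> bool" where
  "C1_halfline \<phi> \<longleftrightarrow>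
     continuous_on {0..} \<phi> \<and>
     (\<forall>t>0. \<phi> differentiable (at t)) \<and>
     continuous_on {0<..} (deriv \<phi>) \<and>
     (\<exists>L. (deriv \<phi> \<longlongrightarrow> L) (at_right 0))"

definition deriv_halfline :: "(real \<Rightarrow> real) \<Rightarrow> real \<Rightarrow> real" where
  "deriv_halfline \<phi> t = (if t > 0 then deriv \<phi> t else Lim (at_right 0) (deriv \<phi>))"

definition admissible :: "real \<Rightarrow> 'a::metric_space set set" where
  "admissible l = {S. S \<noteq> {} \<and> compact S \<and> connected S \<and> hausdorff1 S \<le> ennreal l}"

definition objective :: "(real \<Rightarrow> real) \<Rightarrow> 'a::metric_space measure \<Rightarrow> 'a set \<Rightarrow> real" where
  "objective \<phi> \<mu> S = (LINT x|\<mu>. \<phi> (infdist x S))"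

definition closest_point_projections :: "'a::metric_space set \<Rightarrow> ('a \<Rightarrow> 'a) set" where
  "closest_point_projections S =
     {p \<in> borel_measurable borel. \<forall>x. p x \<in> S \<and> dist x (p x) = infdist x S}"

(* \<kappa> \<sigma> is the fibre measure over \<sigma>. The family is indexed by the whole space, but only its values
   for almost every \<sigma> with respect to the image measure matter. Concentration on the fibre cannot
   be asked for every \<sigma>, since the fibre over a point outside the range of p is empty. *)
definition disintegration ::
    "'a::metric_space measure \<Rightarrow> ('a \<Rightarrow> 'a) \<Rightarrow> ('a \<Rightarrow> 'a measure) \<Rightarrow> bool" where
  "disintegration \<mu> p \<kappa> \<longleftrightarrow>
     \<kappa> \<in> borel \<rightarrow>\<^sub>M prob_algebra borel \<and>
     (AE \<sigma> in distr \<mu> borel p. AE x in \<kappa> \<sigma>. x \<in> p -` {\<sigma>}) \<and>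
     (\<forall>A\<in>sets borel. emeasure \<mu> A = (\<integral>\<^sup>+ \<sigma>. emeasure (\<kappa> \<sigma>) A \<partial>(distr \<mu> borel p)))"

(* sgn v is v divided by its norm, and sgn 0 = 0, which is the convention for the integrand at
   points x = p x. *)
definition barycentre ::
    "(real \<Rightarrow> real) \<Rightarrow> ('a::euclidean_space \<Rightarrow> 'a) \<Rightarrow> ('a \<Rightarrow> 'a measure) \<Rightarrow> 'a \<Rightarrow> 'a" where
  "barycentre \<phi> p \<kappa> \<sigma> =
     (LINT x:p -` {\<sigma>}|\<kappa> \<sigma>. deriv_halfline \<phi> (norm (x - p x)) *\<^sub>R sgn (x - p x))"

definition noncut_point :: "'a::topological_space set \<Rightarrow> 'a \<Rightarrow> bool" where
  "noncut_point S \<sigma> \<longleftrightarrow> \<sigma> \<in> S \<and> connected (S - {\<sigma>})"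

definition atom_of :: "'a::metric_space measure \<Rightarrow> 'a set \<Rightarrow> 'a \<Rightarrow> bool" where
  "atom_of \<mu> S \<sigma> \<longleftrightarrow> \<sigma> \<in> S \<and> measure \<mu> {x. infdist x S = dist x \<sigma>} > 0"

end

theory Submission imports Defs begin

text \<open>Shortening the optimal set \<open>S\<close> near a noncut point \<open>a\<close> frees length, and the freed length
can be spent on moving the rest of \<open>S\<close> in a direction that lowers the cost. Optimality says
that the gain does not exceed the loss, and comparing the two to first order gives the inequality.

To shorten: \<open>S\<close> is a continuum of finite length, hence locally connected
(\<open>continuum_locally_connected\<close>), because by boundary bumping only finitely many components of
a ball in \<open>S\<close> can come near the centre. If \<open>a\<close> does not cut \<open>S\<close>, then a small connected open
piece around \<open>a\<close> can be removed so that a continuum \<open>T\<close> is left. If the piece has radius \<open>s\<close>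
about \<open>a\<close>, at least \<open>s / 2\<close> of length is removed (\<open>cut_off_noncut_point\<close>).

To spend: for a vector field \<open>\<xi>\<close> with Lipschitz constant \<open>L\<close> the map \<open>z \<mapsto> z + t \<xi> z\<close> multiplies
length by at most \<open>1 + t L\<close>. So \<open>T\<close> may be moved by \<open>t = s / (2 L l)\<close> without exceeding the
length \<open>l\<close> (\<open>lipschitz_perturbation_admissible\<close>).

Divide the change of cost by \<open>s\<close> and let \<open>s\<close> tend to \<open>0\<close>. A point \<open>x\<close> projected to \<open>p x \<noteq> a\<close> is
eventually not affected by the cut and contributes \<open>- \<langle>b x, \<xi> (p x)\<rangle> / (2 L l)\<close>, where \<open>b x\<close>
(\<open>cost_gradient\<close>) is the integrand of the barycentre. For the points projected to \<open>a\<close>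
itself, a point of \<open>T\<close> at distance at most \<open>s\<close> replaces \<open>a\<close>; along a subsequence this adds
\<open>- \<langle>u, b x\<rangle>\<close> with one vector \<open>u\<close> of norm at most 1. Optimality of \<open>S\<close> makes the total
nonnegative, which is \<open>noncut_point_variation\<close>:
\<open>\<integral> \<langle>b x, \<xi> (p x)\<rangle> \<le> 2 L l \<cdot> |\<integral> b x over {p x = a}|\<close>. Disintegration turns the right side into
the norm of the barycentre at \<open>a\<close> times the mass of \<open>a\<close>, and the left side into the pairing of
\<open>\<xi>\<close> with the barycentre field. If that field is not almost everywhere \<open>0\<close>, some Lipschitz \<open>\<xi>\<close>
makes the pairing positive (\<open>exists_increasing_direction\<close>). This \<open>\<xi>\<close> is independent of \<open>a\<close>, so
it yields one constant for all noncut points. Since the barycentre field is essentially bounded,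
every noncut point then carries at least a fixed amount of mass, so there are finitely many.\<close>

section \<open>The Hausdorff 1-measure\<close>

lemma diameter_least:
  assumes "0 \<le> d" and "\<And>x y. x \<in> U \<Longrightarrow> y \<in> U \<Longrightarrow> dist x y \<le> d"
  shows "diameter U \<le> d"
  using assms unfolding diameter_def by (auto intro!: cSUP_least)

lemma hausdorff1_delta_le:
  assumes "E \<subseteq> (\<Union>i::nat. U i)" and "\<And>i. bounded (U i)" and "\<And>i. diameter (U i) \<le> \<delta>"
  shows "hausdorff1_delta \<delta> E \<le> (\<Sum>i. ennreal (diameter (U i)))"
  unfolding hausdorff1_delta_def by (rule INF_lower) (use assms in auto)

lemma hausdorff1_delta_le_hausdorff1: "0 < \<delta> \<Longrightarrow> hausdorff1_delta \<delta> E \<le> hausdorff1 E"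
  unfolding hausdorff1_def by (rule SUP_upper) auto

lemma hausdorff1_delta_antimono:
  "\<delta> \<le> \<delta>' \<Longrightarrow> hausdorff1_delta \<delta>' E \<le> hausdorff1_delta \<delta> E"
  unfolding hausdorff1_delta_def by (rule INF_superset_mono) (auto intro: order_trans)

lemma hausdorff1_mono:
  assumes "A \<subseteq> B" shows "hausdorff1 A \<le> hausdorff1 B"
  unfolding hausdorff1_def hausdorff1_delta_def
  by (intro SUP_mono' INF_superset_mono) (use assms in auto)

lemma hausdorff1_lipschitz_image:
  fixes f :: "'a::metric_space \<Rightarrow> 'b::metric_space"
  assumes "L-lipschitz_on E f" and "0 < L"
  shows "hausdorff1 (f ` E) \<le> ennreal L * hausdorff1 E"
proof -
  have "hausdorff1_delta \<delta> (f ` E) \<le> ennreal L * hausdorff1 E" if "0 < \<delta>" for \<delta>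
  proof -
    have *: "hausdorff1_delta \<delta> (f ` E) \<le> ennreal L * (\<Sum>i. ennreal (diameter (U i)))"
      if U: "E \<subseteq> (\<Union>i. U i)" "\<And>i. bounded (U i)" "\<And>i. diameter (U i) \<le> \<delta> / L"
      for U :: "nat \<Rightarrow> 'a set"
    proof -
      define V where "V i = f ` (E \<inter> U i)" for i
      have dist_V: "dist x y \<le> L * diameter (U i)" if xy: "x \<in> V i" "y \<in> V i" for x y i
      proof -
        from xy obtain a b where ab: "a \<in> E" "b \<in> E" "a \<in> U i" "b \<in> U i" "x = f a" "y = f b"
          unfolding V_def by auto
        then have "dist x y \<le> L * dist a b"
          using lipschitz_onD[OF assms(1)] by blast
        also have "\<dots> \<le> L * diameter (U i)"
          using diameter_bounded_bound[OF U(2)] ab \<open>0 < L\<close> by (simp add: mult_left_mono)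
        finally show ?thesis .
      qed
      have diam_V: "diameter (V i) \<le> L * diameter (U i)" for i
        using dist_V \<open>0 < L\<close> diameter_ge_0[OF U(2)] by (intro diameter_least) auto
      have bounded_V: "bounded (V i)" for i
        unfolding bounded_two_points using dist_V by blast
      have "hausdorff1_delta \<delta> (f ` E) \<le> (\<Sum>i. ennreal (diameter (V i)))"
      proof (rule hausdorff1_delta_le)
        show "f ` E \<subseteq> (\<Union>i. V i)" using U(1) unfolding V_def by blast
        show "diameter (V i) \<le> \<delta>" for i
          using diam_V[of i] mult_left_mono[OF U(3)[of i], of L] \<open>0 < L\<close> by simp
      qed (rule bounded_V)
      also have "\<dots> \<le> (\<Sum>i. ennreal L * ennreal (diameter (U i)))"
        using diam_V \<open>0 < L\<close> by (intro suminf_le) (auto simp flip: ennreal_mult' intro!: ennreal_leI)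
      finally show ?thesis by simp
    qed
    have cancel: "ennreal (1 / L) * (ennreal L * X) = X" "ennreal L * (ennreal (1 / L) * X) = X" for X
      using \<open>0 < L\<close> by (simp_all flip: mult.assoc ennreal_mult')
    have "ennreal (1 / L) * hausdorff1_delta \<delta> (f ` E) \<le> hausdorff1_delta (\<delta> / L) E"
      unfolding hausdorff1_delta_def[of "\<delta> / L"]
    proof (rule INF_greatest)
      fix U :: "nat \<Rightarrow> 'a set"
      assume "U \<in> {U. E \<subseteq> (\<Union>i. U i) \<and> (\<forall>i. bounded (U i) \<and> diameter (U i) \<le> \<delta> / L)}"
      then have "hausdorff1_delta \<delta> (f ` E) \<le> ennreal L * (\<Sum>i. ennreal (diameter (U i)))"
        by (intro *) auto
      from mult_left_mono[OF this zero_le, of "ennreal (1 / L)"]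
      show "ennreal (1 / L) * hausdorff1_delta \<delta> (f ` E) \<le> (\<Sum>i. ennreal (diameter (U i)))"
        by (simp only: cancel)
    qed
    also have "\<dots> \<le> hausdorff1 E"
      using \<open>0 < \<delta>\<close> \<open>0 < L\<close> by (intro hausdorff1_delta_le_hausdorff1) simp
    finally have "ennreal (1 / L) * hausdorff1_delta \<delta> (f ` E) \<le> hausdorff1 E" .
    from mult_left_mono[OF this zero_le, of "ennreal L"] show ?thesis
      by (simp only: cancel)
  qed
  then show ?thesis
    unfolding hausdorff1_def[of "f ` E"] by (intro SUP_least) auto
qed

text \<open>Sets of diameter less than the separation meet at most one of \<open>A\<close> and \<open>B\<close>, so a fine cover of
the union splits into covers of the two parts at no extra cost.\<close>

lemma hausdorff1_add_separated:
  fixes A B :: "'a::metric_space set"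
  assumes "0 < \<epsilon>" and sep: "\<And>a b. a \<in> A \<Longrightarrow> b \<in> B \<Longrightarrow> \<epsilon> \<le> dist a b"
  shows "hausdorff1 A + hausdorff1 B \<le> hausdorff1 (A \<union> B)"
proof -
  have small: "hausdorff1_delta \<delta> A + hausdorff1_delta \<delta> B \<le> hausdorff1 (A \<union> B)"
    if "0 < \<delta>" "\<delta> < \<epsilon>" for \<delta>
  proof -
    have "hausdorff1_delta \<delta> A + hausdorff1_delta \<delta> B \<le> (\<Sum>i. ennreal (diameter (U i)))"
      if U: "A \<union> B \<subseteq> (\<Union>i. U i)" "\<And>i. bounded (U i)" "\<And>i. diameter (U i) \<le> \<delta>"
      for U :: "nat \<Rightarrow> 'a set"
    proof -
      have one: "A \<inter> U i = {} \<or> B \<inter> U i = {}" for i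
      proof (rule ccontr)
        assume "\<not> ?thesis"
        then obtain a b where "a \<in> A" "a \<in> U i" "b \<in> B" "b \<in> U i" by auto
        then have "\<epsilon> \<le> dist a b" "dist a b \<le> \<delta>"
          using sep order_trans[OF diameter_bounded_bound[OF U(2)] U(3)[of i]] by auto
        then show False using \<open>\<delta> < \<epsilon>\<close> by simp
      qed
      have half: "hausdorff1_delta \<delta> C \<le> (\<Sum>i. ennreal (diameter (C \<inter> U i)))"
        if "C \<subseteq> A \<union> B" for C
      proof (rule hausdorff1_delta_le)
        show "C \<subseteq> (\<Union>i. C \<inter> U i)" using that U(1) by blast
        show "bounded (C \<inter> U i)" for i using U(2) by blast
        show "diameter (C \<inter> U i) \<le> \<delta>" for i
          using diameter_subset[of "C \<inter> U i" "U i"] U(2,3)[of i] by auto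
      qed
      have "hausdorff1_delta \<delta> A + hausdorff1_delta \<delta> B
          \<le> (\<Sum>i. ennreal (diameter (A \<inter> U i))) + (\<Sum>i. ennreal (diameter (B \<inter> U i)))"
        by (intro add_mono half) auto
      also have "\<dots> = (\<Sum>i. ennreal (diameter (A \<inter> U i)) + ennreal (diameter (B \<inter> U i)))"
        by (rule suminf_add) auto
      also have "\<dots> \<le> (\<Sum>i. ennreal (diameter (U i)))"
      proof (rule suminf_le)
        fix i
        show "ennreal (diameter (A \<inter> U i)) + ennreal (diameter (B \<inter> U i)) \<le> ennreal (diameter (U i))"
          using one[of i] diameter_subset[of "A \<inter> U i" "U i"] diameter_subset[of "B \<inter> U i" "U i"] U(2)
          by (auto intro!: ennreal_leI)
      qed auto
      finally show ?thesis .
    qed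
    then have "hausdorff1_delta \<delta> A + hausdorff1_delta \<delta> B \<le> hausdorff1_delta \<delta> (A \<union> B)"
      unfolding hausdorff1_delta_def[of \<delta> "A \<union> B"] by (intro INF_greatest) auto
    also have "\<dots> \<le> hausdorff1 (A \<union> B)"
      using \<open>0 < \<delta>\<close> by (rule hausdorff1_delta_le_hausdorff1)
    finally show ?thesis .
  qed
  have "hausdorff1_delta \<delta> A + hausdorff1_delta \<delta>' B \<le> hausdorff1 (A \<union> B)"
    if "0 < \<delta>" "0 < \<delta>'" for \<delta> \<delta>'
  proof -
    let ?d = "min (\<epsilon> / 2) (min \<delta> \<delta>')"
    have "hausdorff1_delta \<delta> A + hausdorff1_delta \<delta>' B
        \<le> hausdorff1_delta ?d A + hausdorff1_delta ?d B"
      by (intro add_mono hausdorff1_delta_antimono) auto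
    also have "\<dots> \<le> hausdorff1 (A \<union> B)"
      using that \<open>0 < \<epsilon>\<close> by (intro small) auto
    finally show ?thesis .
  qed
  then have "hausdorff1_delta \<delta> A + hausdorff1 B \<le> hausdorff1 (A \<union> B)" if "0 < \<delta>" for \<delta>
    unfolding hausdorff1_def[of B] using that
    by (subst ennreal_SUP_add_right) (auto intro!: SUP_least)
  then show ?thesis
    unfolding hausdorff1_def[of A]
    by (subst ennreal_SUP_add_left[symmetric]) (auto intro!: SUP_least)
qed

text \<open>Replace each covering set by the closed interval from its infimum to its supremum, which has the
same length as the diameter, and compare with Lebesgue measure.\<close>

lemma hausdorff1_interval_ge:
  fixes d :: real
  assumes "{0..d} \<subseteq> E" shows "ennreal d \<le> hausdorff1 E"
proof -
  have "ennreal d \<le> (\<Sum>i. ennreal (diameter (U i)))"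
    if U: "E \<subseteq> (\<Union>i. U i)" "\<And>i. bounded (U i)" for U :: "nat \<Rightarrow> real set"
  proof -
    define V where "V i = (if U i = {} then {} else {Inf (U i)..Sup (U i)})" for i
    have bdd: "bdd_above (U i)" "bdd_below (U i)" for i
      using U(2)[of i] by (auto simp: bounded_imp_bdd_above bounded_imp_bdd_below)
    have UV: "U i \<subseteq> V i" for i
      unfolding V_def using bdd[of i] by (auto intro: cInf_lower cSup_upper)
    have V_le: "emeasure lborel (V i) \<le> ennreal (diameter (U i))" for i
    proof (cases "U i = {}")
      case False
      have dist_le: "x - y \<le> diameter (U i)" if "x \<in> U i" "y \<in> U i" for x y
        using diameter_bounded_bound[OF U(2) that] by (simp add: dist_real_def)
      have "Sup (U i) - diameter (U i) \<le> Inf (U i)"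
      proof (rule cInf_greatest[OF False])
        fix y assume y: "y \<in> U i"
        have "Sup (U i) \<le> y + diameter (U i)"
          using dist_le y by (intro cSup_least[OF False]) (auto simp: algebra_simps)
        then show "Sup (U i) - diameter (U i) \<le> y" by simp
      qed
      moreover have "Inf (U i) \<le> Sup (U i)"
        using False bdd by (simp add: cInf_le_cSup)
      ultimately show ?thesis
        using False by (simp add: V_def ennreal_leI)
    qed (simp add: V_def)
    have "ennreal d \<le> emeasure lborel {0..d}"
      by (cases "0 \<le> d") (auto simp: ennreal_neg)
    also have "\<dots> \<le> emeasure lborel (\<Union>i. V i)"
    proof (rule emeasure_mono)
      show "{0..d} \<subseteq> (\<Union>i. V i)" using assms U(1) UV by blast
      show "(\<Union>i. V i) \<in> sets lborel" by (auto simp: V_def)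
    qed
    also have "\<dots> \<le> (\<Sum>i. emeasure lborel (V i))"
      by (rule emeasure_subadditive_countably) (auto simp: V_def)
    also have "\<dots> \<le> (\<Sum>i. ennreal (diameter (U i)))"
      using V_le by (intro suminf_le) auto
    finally show ?thesis .
  qed
  then have "ennreal d \<le> hausdorff1_delta 1 E"
    unfolding hausdorff1_delta_def by (intro INF_greatest) auto
  also have "\<dots> \<le> hausdorff1 E" by (rule hausdorff1_delta_le_hausdorff1) simp
  finally show ?thesis .
qed

text \<open>The distance from \<open>a\<close> is 1-Lipschitz and maps a connected set onto a set containing
\<open>{0..dist a b}\<close>.\<close>

lemma hausdorff1_connected_ge_dist:
  fixes Q :: "'a::metric_space set"
  assumes "connected Q" "a \<in> Q" "b \<in> Q"
  shows "ennreal (dist a b) \<le> hausdorff1 Q"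
proof -
  have "connected (dist a ` Q)"
    using assms(1) by (intro connected_continuous_image continuous_intros)
  then have "{0..dist a b} \<subseteq> dist a ` Q"
    by (rule connected_contains_Icc) (use assms in force)+
  then have "ennreal (dist a b) \<le> hausdorff1 (dist a ` Q)"
    by (rule hausdorff1_interval_ge)
  also have "\<dots> \<le> ennreal 1 * hausdorff1 Q"
  proof (rule hausdorff1_lipschitz_image)
    show "1-lipschitz_on Q (dist a)"
      using abs_dist_diff_le[of _ a] by (intro lipschitz_onI) (auto simp: dist_real_def dist_commute)
  qed simp
  finally show ?thesis by simp
qed

section \<open>Continua of finite length\<close>

lemma hausdorff1_add_disjoint_compact:
  fixes A B :: "'a::heine_borel set"
  assumes "compact A" "compact B" "A \<inter> B = {}"
  shows "hausdorff1 A + hausdorff1 B \<le> hausdorff1 (A \<union> B)"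
proof -
  obtain \<epsilon> where "0 < \<epsilon>" "\<And>a b. a \<in> A \<Longrightarrow> b \<in> B \<Longrightarrow> \<epsilon> \<le> dist a b"
    using separate_compact_closed[of A B] assms compact_imp_closed by blast
  then show ?thesis by (rule hausdorff1_add_separated)
qed

lemma sum_hausdorff1_disjoint_compact_le:
  fixes F :: "'a::heine_borel set set"
  assumes "finite F" "\<And>C. C \<in> F \<Longrightarrow> compact C" "disjoint F"
  shows "(\<Sum>C\<in>F. hausdorff1 C) \<le> hausdorff1 (\<Union>F)"
  using assms
proof (induction F rule: finite_induct)
  case (insert C F)
  have "(\<Sum>D\<in>insert C F. hausdorff1 D) \<le> hausdorff1 C + hausdorff1 (\<Union>F)"
    using insert by (simp add: add_left_mono pairwise_insert)
  also have "\<dots> \<le> hausdorff1 (C \<union> \<Union>F)"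
  proof (rule hausdorff1_add_disjoint_compact)
    show "compact (\<Union>F)" using insert by (intro compact_Union) auto
    show "C \<inter> \<Union>F = {}" using insert by (auto simp: pairwise_insert disjnt_def)
  qed (use insert in auto)
  finally show ?case by simp
qed simp

text \<open>A component of the part of a continuum in a ball reaches the sphere. Otherwise the component,
being an intersection of relatively clopen sets, has a clopen neighbourhood inside the open ball,
and that neighbourhood is clopen in the whole of \<open>S\<close>.\<close>

lemma boundary_bumping:
  fixes S :: "'a::euclidean_space set"
  assumes "compact S" "connected S" and C: "C \<in> components (S \<inter> cball x R)"
    and "\<not> S \<subseteq> ball x R"
  obtains z where "z \<in> C" "dist x z = R"
proof -
  let ?K = "S \<inter> cball x R"
  have K: "compact ?K" using assms(1) by (simp add: compact_Int)
  have CK: "C \<subseteq> ?K" using C by (rule in_components_subset)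
  have "\<not> C \<subseteq> ball x R"
  proof
    assume "C \<subseteq> ball x R"
    moreover have "compact C"
      using C K compact_components by blast
    moreover have "locally compact ?K"
      using K by (simp add: closed_imp_locally_compact compact_imp_closed)
    ultimately obtain V where V: "openin (top_of_set ?K) V" "compact V" "C \<subseteq> V" "V \<subseteq> ball x R"
      using Sura_Bura_clopen_subset[OF _ C] open_ball by metis
    obtain W where W: "open W" "V = ?K \<inter> W"
      using V(1) by (auto simp: openin_open)
    \<comment> \<open>Since \<open>V\<close> stays inside the open ball, it is open in \<open>S\<close> and not only in \<open>S \<inter> cball x R\<close>.\<close>
    then have "V = S \<inter> (ball x R \<inter> W)" using V(4) by auto
    then have "openin (top_of_set S) V" using W(1) by (metis open_Int open_ball openin_open_Int)
    moreover have "closedin (top_of_set S) V"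
      using V(2) W(2) by (intro closed_subset compact_imp_closed) auto
    moreover have "V \<noteq> {}" using V(3) C in_components_nonempty by blast
    ultimately have "V = S" using assms(2) by (auto simp: connected_clopen)
    then show False using V(4) assms(4) by blast
  qed
  then show thesis using CK that by force
qed

text \<open>Each of these components runs from the half ball to the sphere, so it has length at least
\<open>R / 2\<close>; the components are disjoint compact sets and their lengths add up to at most \<open>l\<close>.\<close>

lemma finite_components_meeting_half_ball:
  fixes S :: "'a::euclidean_space set"
  assumes "compact S" "connected S" and l: "hausdorff1 S \<le> ennreal l" and "0 < R"
  shows "finite {C \<in> components (S \<inter> cball x R). C \<inter> cball x (R / 2) \<noteq> {}}" (is "finite ?F")
proof (cases "S \<subseteq> ball x R")
  case True
  then have "S \<inter> cball x R = S" by auto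
  then show ?thesis
    using assms(2) by (cases "S = {}") (auto simp: components_eq_sing_iff[THEN iffD2])
next
  case False
  have big: "ennreal (R / 2) \<le> hausdorff1 C" if C: "C \<in> ?F" for C
  proof -
    obtain z where "z \<in> C" "dist x z = R"
      using boundary_bumping[OF assms(1,2) _ False] C by blast
    moreover obtain y where "y \<in> C" "dist x y \<le> R / 2" using C by auto
    moreover have "dist x z \<le> dist x y + dist y z" by (rule dist_triangle)
    ultimately have "R / 2 \<le> dist y z" by simp
    then have "ennreal (R / 2) \<le> ennreal (dist y z)" by (rule ennreal_leI)
    also have "\<dots> \<le> hausdorff1 C"
      using C \<open>y \<in> C\<close> \<open>z \<in> C\<close> by (intro hausdorff1_connected_ge_dist in_components_connected) auto
    finally show ?thesis .
  qed
  have "finite ?F \<and> card ?F \<le> nat \<lfloor>2 * max 0 l / R\<rfloor>"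
  proof (rule finite_if_finite_subsets_card_bdd)
    fix G assume G: "G \<subseteq> ?F" "finite G"
    have "ennreal (card G * (R / 2)) = (\<Sum>C\<in>G. ennreal (R / 2))"
      using \<open>0 < R\<close> by (simp only: sum_constant ennreal_of_nat_eq_real_of_nat ennreal_mult'')
    also have "\<dots> \<le> (\<Sum>C\<in>G. hausdorff1 C)" using big G(1) by (intro sum_mono) blast
    also have "\<dots> \<le> hausdorff1 (\<Union>G)"
    proof (rule sum_hausdorff1_disjoint_compact_le[OF G(2)])
      show "compact C" if "C \<in> G" for C
        using that G compact_components[of "S \<inter> cball x R"] assms(1) by (auto simp: compact_Int)
      show "disjoint G"
        using G pairwise_disjoint_components[of "S \<inter> cball x R"] by (auto simp: pairwise_def disjnt_def)
    qed
    also have "\<dots> \<le> hausdorff1 S"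
      using G in_components_subset by (intro hausdorff1_mono) fastforce
    also have "\<dots> \<le> ennreal l" by (rule l)
    finally have "ennreal (card G * (R / 2)) \<le> ennreal l" .
    then have "card G * (R / 2) \<le> max 0 l"
      using \<open>0 < R\<close> by (cases "0 \<le> l") (auto simp: ennreal_neg)
    then show "card G \<le> nat \<lfloor>2 * max 0 l / R\<rfloor>"
      using \<open>0 < R\<close> by (simp add: le_nat_floor field_simps)
  qed
  then show ?thesis by simp
qed

text \<open>The other components that come near \<open>x\<close> form a finite family of closed sets, so they stay at a
positive distance from \<open>x\<close>.\<close>

lemma continuum_component_neighbourhood:
  fixes S :: "'a::euclidean_space set"
  assumes "compact S" "connected S" and l: "hausdorff1 S \<le> ennreal l" and "x \<in> S" "0 < R"
  obtains \<delta> where "0 < \<delta>" "S \<inter> ball x \<delta> \<subseteq> connected_component_set (S \<inter> cball x R) x"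
proof -
  let ?K = "S \<inter> cball x R"
  define F where "F = {C \<in> components ?K. C \<inter> cball x (R / 2) \<noteq> {}} - {connected_component_set ?K x}"
  have xK: "x \<in> ?K" using assms by auto
  have "finite F"
    unfolding F_def using finite_components_meeting_half_ball[OF assms(1,2) l \<open>0 < R\<close>] by auto
  moreover have "compact C" if "C \<in> F" for C
    using that compact_components[of ?K] assms(1) by (auto simp: F_def compact_Int)
  ultimately have "closed (\<Union>F)" by (auto intro!: closed_Union compact_imp_closed)
  moreover have "x \<notin> \<Union>F"
  proof
    assume "x \<in> \<Union>F"
    then obtain C where "C \<in> components ?K" "C \<noteq> connected_component_set ?K x" "x \<in> C"
      by (auto simp: F_def)
    then show False
      using connected_component_eq by (fastforce simp: components_def)
  qed
  ultimately obtain e where e: "0 < e" "ball x e \<subseteq> - \<Union>F"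
    using open_contains_ball[of "- \<Union>F"] by (metis Compl_iff open_Compl)
  show thesis
  proof
    show "0 < min e (R / 2)" using e \<open>0 < R\<close> by simp
    show "S \<inter> ball x (min e (R / 2)) \<subseteq> connected_component_set ?K x"
    proof
      fix y assume y: "y \<in> S \<inter> ball x (min e (R / 2))"
      then have "dist x y < R / 2" "y \<in> S" by auto
      then have yK: "y \<in> ?K" using zero_le_dist[of x y] unfolding Int_iff mem_cball by linarith
      define C where "C = connected_component_set ?K y"
      have "y \<in> C" unfolding C_def using yK by simp
      moreover have "C \<in> components ?K" using yK by (auto simp: C_def components_def)
      moreover have "y \<notin> \<Union>F" using y e(2) by auto
      moreover have "y \<in> cball x (R / 2)" using y by simp
      ultimately have "C = connected_component_set ?K x" unfolding F_def by blast
      then show "y \<in> connected_component_set ?K x" using \<open>y \<in> C\<close> by simp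
    qed
  qed
qed

text \<open>Being joined by a subcontinuum of \<open>U\<close> is an equivalence relation on \<open>U\<close>, and its classes are
open since every point has a neighbourhood in \<open>S\<close> contained in a small continuum.\<close>

lemma open_connected_compact_join:
  fixes S :: "'a::euclidean_space set"
  assumes "compact S" "connected S" and l: "hausdorff1 S \<le> ennreal l"
    and U: "openin (top_of_set S) U" "connected U" and "a \<in> U" "b \<in> U"
  obtains Q where "compact Q" "connected Q" "Q \<subseteq> U" "a \<in> Q" "b \<in> Q"
proof -
  define R where "R x y \<longleftrightarrow> (\<exists>Q. compact Q \<and> connected Q \<and> Q \<subseteq> U \<and> x \<in> Q \<and> y \<in> Q)" for x y
  have "R a b"
  proof (rule connected_equivalence_relation[OF U(2) assms(6,7)])
    show "R y x" if "R x y" for x y using that by (auto simp: R_def)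
    show "R x z" if "R x y" "R y z" for x y z
    proof -
      from that obtain P Q where "compact P" "connected P" "P \<subseteq> U" "x \<in> P" "y \<in> P"
        "compact Q" "connected Q" "Q \<subseteq> U" "y \<in> Q" "z \<in> Q" unfolding R_def by metis
      then show ?thesis
        unfolding R_def by (intro exI[of _ "P \<union> Q"]) (auto intro!: connected_Un compact_Un)
    qed
    fix x assume x: "x \<in> U"
    then obtain e where e: "0 < e" "cball x e \<inter> S \<subseteq> U" and xS: "x \<in> S"
      using U(1) unfolding openin_contains_cball by blast
    let ?K = "connected_component_set (S \<inter> cball x e) x"
    obtain \<delta> where \<delta>: "0 < \<delta>" "S \<inter> ball x \<delta> \<subseteq> ?K"
      using continuum_component_neighbourhood[OF assms(1,2) l xS e(1)] by blast
    have K: "compact ?K" "connected ?K" "?K \<subseteq> U"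
      using e connected_component_subset[of "S \<inter> cball x e" x]
        compact_components[of "S \<inter> cball x e" ?K] assms(1) xS
      by (auto simp: compact_Int components_def)
    have "x \<in> ?K" using \<delta> xS by auto
    have "\<forall>y\<in>U \<inter> ball x \<delta>. R x y"
    proof
      fix y assume "y \<in> U \<inter> ball x \<delta>"
      then have "y \<in> ?K" using \<delta> U(1) openin_imp_subset by blast
      then show "R x y" unfolding R_def using K \<open>x \<in> ?K\<close> by blast
    qed
    then show "\<exists>T. openin (top_of_set U) T \<and> x \<in> T \<and> (\<forall>y\<in>T. R x y)"
      using x \<delta>(1) by (intro exI[of _ "U \<inter> ball x \<delta>"]) (auto intro: openin_open_Int)
  qed
  then show thesis using that by (auto simp: R_def)
qed

lemma continuum_locally_connected:
  fixes S :: "'a::euclidean_space set"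
  assumes "compact S" "connected S" and l: "hausdorff1 S \<le> ennreal l"
  shows "locally connected S"
  unfolding locally_connected_im_kleinen
proof (intro allI impI)
  fix V x assume V: "openin (top_of_set S) V \<and> x \<in> V"
  then obtain e where e: "0 < e" "cball x e \<inter> S \<subseteq> V" and "x \<in> S"
    unfolding openin_contains_cball by blast
  let ?K = "connected_component_set (S \<inter> cball x e) x"
  obtain \<delta> where \<delta>: "0 < \<delta>" "S \<inter> ball x \<delta> \<subseteq> ?K"
    using continuum_component_neighbourhood[OF assms \<open>x \<in> S\<close> e(1)] by blast
  have K: "connected ?K" "?K \<subseteq> V"
    using e connected_component_subset[of "S \<inter> cball x e" x] by auto
  have "x \<in> ?K" using \<delta> \<open>x \<in> S\<close> by auto
  then show "\<exists>U. openin (top_of_set S) U \<and> x \<in> U \<and> U \<subseteq> V \<and>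
      (\<forall>y. y \<in> U \<longrightarrow> (\<exists>c. connected c \<and> c \<subseteq> V \<and> x \<in> c \<and> y \<in> c))"
    using K \<delta> \<open>x \<in> S\<close>
    by (intro exI[of _ "S \<inter> ball x \<delta>"] conjI allI impI exI[of _ ?K])
       (auto intro: openin_open_Int)
qed

text \<open>The part of \<open>S\<close> away from \<open>a\<close> is compact, so finitely many small continua cover it; each is
connected to the base point \<open>b\<close> by a continuum that avoids \<open>a\<close>.\<close>

lemma continuum_minus_noncut_point_exhausted:
  fixes S :: "'a::euclidean_space set"
  assumes "compact S" "connected S" and l: "hausdorff1 S \<le> ennreal l"
    and "noncut_point S a" "0 < r" and b: "b \<in> S" "r \<le> dist a b"
  obtains K where "compact K" "connected K" "K \<subseteq> S - {a}" "S - ball a r \<subseteq> K" "b \<in> K"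
proof -
  let ?U = "S - {a}"
  have U: "openin (top_of_set S) ?U" "connected ?U"
    using assms(4) by (auto simp: noncut_point_def openin_delete)
  have bU: "b \<in> ?U" using b \<open>0 < r\<close> by auto
  have "\<exists>\<delta> P. 0 < \<delta> \<and> compact P \<and> connected P \<and> P \<subseteq> ?U \<and> b \<in> P \<and> S \<inter> ball y \<delta> \<subseteq> P"
    if y: "y \<in> S - ball a r" for y
  proof -
    have yU: "y \<in> ?U" using y \<open>0 < r\<close> by auto
    then obtain e where e: "0 < e" "cball y e \<inter> S \<subseteq> ?U"
      using U(1) unfolding openin_contains_cball by blast
    let ?K = "connected_component_set (S \<inter> cball y e) y"
    obtain \<delta> where \<delta>: "0 < \<delta>" "S \<inter> ball y \<delta> \<subseteq> ?K"
      using continuum_component_neighbourhood[OF assms(1-3) _ e(1)] yU by blast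
    have "y \<in> ?K" using \<delta> yU by auto
    have K: "compact ?K" "connected ?K" "?K \<subseteq> ?U"
      using e connected_component_subset[of "S \<inter> cball y e" y]
        compact_components[of "S \<inter> cball y e" ?K] assms(1) yU
      by (auto simp: compact_Int components_def)
    obtain Q where Q: "compact Q" "connected Q" "Q \<subseteq> ?U" "b \<in> Q" "y \<in> Q"
      using open_connected_compact_join[OF assms(1-3) U bU yU] by blast
    have "connected (?K \<union> Q)" using K Q \<open>y \<in> ?K\<close> by (intro connected_Un) blast+
    then show ?thesis
      using K Q \<delta> by (intro exI[of _ \<delta>] exI[of _ "?K \<union> Q"]) auto
  qed
  then obtain \<delta> P where P: "\<And>y. y \<in> S - ball a r \<Longrightarrow> 0 < \<delta> y \<and> compact (P y) \<and> connected (P y) \<and>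
      P y \<subseteq> ?U \<and> b \<in> P y \<and> S \<inter> ball y (\<delta> y) \<subseteq> P y"
    by metis
  have "compact (S - ball a r)" using assms(1) by (simp add: compact_diff)
  moreover have "S - ball a r \<subseteq> (\<Union>y\<in>S - ball a r. ball y (\<delta> y))" using P by force
  ultimately obtain C where C: "C \<subseteq> S - ball a r" "finite C" "S - ball a r \<subseteq> (\<Union>y\<in>C. ball y (\<delta> y))"
    using compactE_image[of "S - ball a r" "S - ball a r" "\<lambda>y. ball y (\<delta> y)"] open_ball by blast
  have "C \<noteq> {}" using C(3) b by auto
  show thesis
  proof
    have PC: "compact (P y)" "connected (P y)" "b \<in> P y" "P y \<subseteq> ?U" "S \<inter> ball y (\<delta> y) \<subseteq> P y"
      if "y \<in> C" for y
      using P C(1) that by blast+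
    show "compact (\<Union>(P ` C))" using C(2) PC by blast
    show "connected (\<Union>(P ` C))" using PC(2,3) by (intro connected_Union) blast+
    show "\<Union>(P ` C) \<subseteq> ?U" using PC(4) by blast
    show "S - ball a r \<subseteq> \<Union>(P ` C)" using C(3) PC(5) by blast
    show "b \<in> \<Union>(P ` C)" using PC(3) \<open>C \<noteq> {}\<close> by blast
  qed
qed

text \<open>Here a small piece containing the noncut point \<open>a\<close> is removed. The piece is the component \<open>C\<close>
of \<open>a\<close> in the complement of a large continuum \<open>K\<close> that avoids \<open>a\<close>: it is open by local
connectedness, so what is left is closed, and removing a component of the complement of a
connected set leaves the rest connected. The bound \<open>s\<close> on the size of the piece is essentially
attained in it, which makes the loss of length comparable to \<open>s\<close>.\<close>

lemma cut_off_noncut_point: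
  fixes S :: "'a::euclidean_space set"
  assumes S: "compact S" "connected S" and l: "hausdorff1 S \<le> ennreal l"
    and a: "noncut_point S a" "S \<noteq> {a}" and "0 < r"
  obtains T q s where "0 < s" "s \<le> r" "T \<subseteq> S" "compact T" "connected T" "a \<notin> T"
    "q \<in> T" "dist q a \<le> s" "S - T \<subseteq> cball a s"
    "hausdorff1 T + ennreal (s / 2) \<le> hausdorff1 S"
proof -
  have aS: "a \<in> S" using a by (simp add: noncut_point_def)
  then obtain b where b: "b \<in> S" "b \<noteq> a" using a(2) by auto
  define R where "R = min r (dist a b)"
  have R: "0 < R" "R \<le> r" "R \<le> dist a b" using b \<open>0 < r\<close> by (auto simp: R_def)
  obtain K where K: "compact K" "connected K" "K \<subseteq> S - {a}" "S - ball a R \<subseteq> K" "b \<in> K"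
    using continuum_minus_noncut_point_exhausted[OF S l a(1) R(1) b(1) R(3)] by blast
  let ?W = "S - K"
  define C where "C = connected_component_set ?W a"
  define T where "T = S - C"
  have aW: "a \<in> ?W" using aS K by auto
  have W: "openin (top_of_set S) ?W"
    using K(1) compact_imp_closed by (metis Diff_subset K(3) closed_subset openin_diff openin_subtopology_self subset_trans)
  have C: "C \<in> components ?W" using aW by (auto simp: C_def components_def)
  have "openin (top_of_set ?W) C"
    using C W continuum_locally_connected[OF S l]
    by (meson locally_open_subset openin_components_locally_connected)
  then have C_open: "openin (top_of_set S) C" using W openin_trans by blast
  have aC: "a \<in> C" unfolding C_def using aW by simp
  have CW: "C \<subseteq> ?W" using C by (rule in_components_subset)
  have CR: "C \<subseteq> ball a R" using CW K(4) by auto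
  have "C \<noteq> S" using CW b K(5) by auto
  have clopen: "C = {} \<or> C = S" if "closedin (top_of_set S) C"
    using that C_open S(2) by (auto simp: connected_clopen)
  \<comment> \<open>Otherwise \<open>a\<close> would be an isolated point of the continuum \<open>S\<close>.\<close>
  have "C \<noteq> {a}"
    using clopen aC \<open>C \<noteq> S\<close> aS by (metis closed_singleton closed_subset empty_not_insert empty_subsetI insert_subset)
  then obtain c where c: "c \<in> C" "c \<noteq> a" using aC by auto
  \<comment> \<open>The radius of the removed piece. A continuum inside \<open>C\<close> from \<open>a\<close> to a point at distance more
    than \<open>s / 2\<close> accounts for the lost length.\<close>
  define s where "s = (SUP x\<in>C. dist a x)"
  have bdd: "bdd_above (dist a ` C)" using CR by (intro bdd_aboveI[of _ R]) force
  have s_upper: "dist a x \<le> s" if "x \<in> C" for x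
    unfolding s_def using bdd that by (rule cSUP_upper2) simp
  have "0 < s" using s_upper[OF c(1)] c(2) by (metis dist_pos_lt less_le_trans)
  have "s \<le> R" unfolding s_def using aC CR by (intro cSUP_least) force+
  obtain x where x: "x \<in> C" "s / 2 < dist a x"
    using less_cSUP_iff[OF _ bdd, of "s / 2"] aC \<open>0 < s\<close> unfolding s_def by auto
  obtain Q where Q: "compact Q" "connected Q" "Q \<subseteq> C" "a \<in> Q" "x \<in> Q"
    using open_connected_compact_join[OF S l C_open in_components_connected[OF C] aC x(1)] by blast
  have T: "compact T" "connected T" "T \<subseteq> S"
  proof -
    have "closedin (top_of_set S) T" unfolding T_def using C_open by (simp add: closedin_diff)
    then show "compact T" using S(1) closedin_compact by blast
    show "connected T" unfolding T_def
      using component_diff_connected[OF K(2) S(2) _ C] K(3) by auto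
  qed (auto simp: T_def)
  \<comment> \<open>If \<open>T\<close> stayed farther than \<open>s\<close> from \<open>a\<close>, then \<open>C\<close> would be closed as well as open.\<close>
  have "\<exists>q\<in>T. dist q a \<le> s"
  proof (rule ccontr)
    assume "\<not> ?thesis"
    then have "C = S \<inter> cball a s"
      using s_upper CW by (auto simp: T_def dist_commute)
    then have "closedin (top_of_set S) C" by (metis closed_cball closedin_closed_Int)
    then show False using clopen aC \<open>C \<noteq> S\<close> by auto
  qed
  then obtain q where q: "q \<in> T" "dist q a \<le> s" by blast
  have "ennreal (s / 2) \<le> ennreal (dist a x)" using x(2) by (intro ennreal_leI) simp
  also have "\<dots> \<le> hausdorff1 Q" using Q by (intro hausdorff1_connected_ge_dist)
  finally have "hausdorff1 T + ennreal (s / 2) \<le> hausdorff1 T + hausdorff1 Q"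
    by (rule add_left_mono)
  also have "\<dots> \<le> hausdorff1 (T \<union> Q)"
    using T Q by (intro hausdorff1_add_disjoint_compact) (auto simp: T_def)
  also have "\<dots> \<le> hausdorff1 S"
    using T Q CW by (intro hausdorff1_mono) auto
  finally have "hausdorff1 T + ennreal (s / 2) \<le> hausdorff1 S" .
  moreover have "S - T \<subseteq> cball a s" using s_upper by (auto simp: T_def)
  moreover have "a \<notin> T" using aC by (simp add: T_def)
  ultimately show thesis
    using that[of s T q] \<open>0 < s\<close> \<open>s \<le> R\<close> R(2) T q by linarith
qed

section \<open>Supports and disintegrations\<close>

lemma compl_msupport: "- msupport \<mu> = \<Union>{U. open U \<and> emeasure \<mu> U = 0}"
  by (auto simp: msupport_def zero_less_iff_neq_zero)

lemma closed_msupport: "closed (msupport \<mu>)"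
proof -
  have "open (- msupport \<mu>)" unfolding compl_msupport by (intro open_Union) simp
  then show ?thesis by (simp add: closed_def)
qed

text \<open>By Lindelof, countably many null open sets cover the complement of the support.\<close>

lemma emeasure_compl_msupport:
  fixes \<mu> :: "'a::second_countable_topology measure"
  assumes "sets \<mu> = sets borel"
  shows "emeasure \<mu> (- msupport \<mu>) = 0"
proof -
  let ?U = "{U. open U \<and> emeasure \<mu> U = 0}"
  obtain F where F: "F \<subseteq> ?U" "countable F" "\<Union>F = \<Union>?U"
    using Lindelof[of ?U] by auto
  moreover have "\<Union>F \<in> null_sets \<mu>"
    using F(1) by (intro null_sets_UN'[OF F(2), of "\<lambda>x. x", simplified]) (auto simp: null_sets_def assms)
  ultimately show ?thesis unfolding compl_msupport by auto
qed

lemma AE_in_msupport: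
  fixes \<mu> :: "'a::second_countable_topology measure"
  assumes "sets \<mu> = sets borel"
  shows "AE x in \<mu>. x \<in> msupport \<mu>"
proof -
  have "- msupport \<mu> \<in> null_sets \<mu>"
    using emeasure_compl_msupport[OF assms] closed_msupport[of \<mu>] assms by (auto simp: null_sets_def)
  from AE_not_in[OF this] show ?thesis by simp
qed

lemma disintegration_kernel:
  assumes "disintegration \<mu> p \<kappa>"
  shows "\<kappa> \<in> borel \<rightarrow>\<^sub>M subprob_algebra borel"
  using assms measurable_prob_algebraD unfolding disintegration_def by blast

lemma disintegration_prob_space:
  assumes "disintegration \<mu> p \<kappa>"
  shows "prob_space (\<kappa> \<sigma>)"
proof -
  have "\<kappa> \<sigma> \<in> space (prob_algebra borel)"
    using assms by (auto simp: disintegration_def dest: measurable_space)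
  then show ?thesis by (simp add: space_prob_algebra)
qed

text \<open>The disintegration says that \<open>\<mu>\<close> is the average of the fibre measures, that is, the monadic join of
the distribution of \<open>\<kappa>\<close>.\<close>

lemma integral_disintegration:
  fixes f :: "'a::metric_space \<Rightarrow> real"
  assumes \<mu>: "prob_space \<mu>" "sets \<mu> = sets borel"
    and p: "p \<in> borel_measurable borel" and \<kappa>: "disintegration \<mu> p \<kappa>"
    and f: "f \<in> borel_measurable borel" "\<And>x. \<bar>f x\<bar> \<le> B"
  shows "(\<integral>\<sigma>. (\<integral>x. f x \<partial>\<kappa> \<sigma>) \<partial>distr \<mu> borel p) = (\<integral>x. f x \<partial>\<mu>)"
proof -
  let ?\<nu> = "distr \<mu> borel p"
  let ?M = "distr ?\<nu> (subprob_algebra borel) \<kappa>"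
  interpret \<mu>: prob_space \<mu> by (rule \<mu>(1))
  have p': "p \<in> measurable \<mu> borel" using p \<mu>(2) by (simp cong: measurable_cong_sets)
  interpret \<nu>: prob_space ?\<nu> using p' by (rule \<mu>.prob_space_distr)
  have \<kappa>_kernel[measurable]: "\<kappa> \<in> borel \<rightarrow>\<^sub>M subprob_algebra borel"
    using \<kappa> by (rule disintegration_kernel)
  have [measurable]: "\<kappa> \<in> ?\<nu> \<rightarrow>\<^sub>M subprob_algebra borel"
    using \<kappa>_kernel by (simp cong: measurable_cong_sets)
  interpret M: prob_space ?M by (rule \<nu>.prob_space_distr) measurable
  have join: "join ?M = \<mu>"
  proof (rule measure_eqI)
    fix A assume "A \<in> sets (join ?M)"
    then have A: "A \<in> sets borel" by simp
    have "emeasure (join ?M) A = (\<integral>\<^sup>+\<sigma>. emeasure (\<kappa> \<sigma>) A \<partial>?\<nu>)"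
      using A by (simp add: emeasure_join nn_integral_distr measurable_emeasure_subprob_algebra)
    then show "emeasure (join ?M) A = emeasure \<mu> A"
      using \<kappa> A unfolding disintegration_def by simp
  qed (simp add: \<mu>(2))
  have "(\<integral>x. f x \<partial>join ?M) = (\<integral>M'. (\<integral>x. f x \<partial>M') \<partial>?M)"
  proof (rule integral_join)
    show "AE M' in ?M. emeasure M' (space M') \<le> ennreal 1"
    proof (rule AE_I2)
      fix M' :: "'a measure" assume "M' \<in> space ?M"
      then have "subprob_space M'" by (simp add: space_subprob_algebra)
      then show "emeasure M' (space M') \<le> ennreal 1" by (simp add: subprob_space.emeasure_space_le_1)
    qed
    show "f \<in> borel_measurable borel" by (rule f(1))
    show "\<And>x. x \<in> space borel \<Longrightarrow> \<bar>f x\<bar> \<le> B" using f(2) by simp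
    show "finite_measure ?M" by unfold_locales
  qed simp
  also have "\<dots> = (\<integral>\<sigma>. (\<integral>x. f x \<partial>\<kappa> \<sigma>) \<partial>?\<nu>)"
    using f(1) by (intro integral_distr) measurable
  finally show ?thesis by (simp add: join)
qed

lemma AE_disintegration:
  assumes \<mu>: "sets \<mu> = sets borel" and p: "p \<in> borel_measurable borel"
    and \<kappa>: "disintegration \<mu> p \<kappa>" and A: "A \<in> sets borel" "emeasure \<mu> A = 0"
  shows "AE \<sigma> in distr \<mu> borel p. AE x in \<kappa> \<sigma>. x \<notin> A"
proof -
  have \<kappa>_kernel[measurable]: "\<kappa> \<in> borel \<rightarrow>\<^sub>M subprob_algebra borel"
    using \<kappa> by (rule disintegration_kernel)
  have [measurable]: "(\<lambda>\<sigma>. emeasure (\<kappa> \<sigma>) A) \<in> borel_measurable (distr \<mu> borel p)"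
    using A(1) by measurable
  have "(\<integral>\<^sup>+ \<sigma>. emeasure (\<kappa> \<sigma>) A \<partial>distr \<mu> borel p) = 0"
    using \<kappa> A unfolding disintegration_def by simp
  then have "AE \<sigma> in distr \<mu> borel p. emeasure (\<kappa> \<sigma>) A = 0"
    by (subst (asm) nn_integral_0_iff_AE) auto
  then show ?thesis
  proof (rule eventually_mono)
    fix \<sigma> assume "emeasure (\<kappa> \<sigma>) A = 0"
    moreover have "sets (\<kappa> \<sigma>) = sets borel"
      using subprob_measurableD(2)[OF \<kappa>_kernel] by simp
    ultimately show "AE x in \<kappa> \<sigma>. x \<notin> A"
      using A(1) by (intro AE_not_in) (auto simp: null_sets_def)
  qed
qed

text \<open>A weight that depends on the base point only may be pulled into the fibre integral, because on
almost every fibre \<open>p\<close> is constant.\<close>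

lemma integral_fibre_weighted:
  fixes g h :: "'a::metric_space \<Rightarrow> real"
  assumes \<mu>: "prob_space \<mu>" "sets \<mu> = sets borel"
    and p: "p \<in> borel_measurable borel" and \<kappa>: "disintegration \<mu> p \<kappa>"
    and g: "g \<in> borel_measurable borel" "\<And>x. \<bar>g x\<bar> \<le> B"
    and h: "h \<in> borel_measurable borel" "\<And>x. \<bar>h x\<bar> \<le> B'"
  shows "(\<integral>\<sigma>. h \<sigma> * (\<integral>x. g x \<partial>\<kappa> \<sigma>) \<partial>distr \<mu> borel p) = (\<integral>x. h (p x) * g x \<partial>\<mu>)"
proof -
  note [measurable] = p g(1) h(1)
  have \<kappa>_kernel[measurable]: "\<kappa> \<in> borel \<rightarrow>\<^sub>M subprob_algebra borel"
    using \<kappa> by (rule disintegration_kernel)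
  have sets_\<kappa>: "sets (\<kappa> \<sigma>) = sets borel" for \<sigma>
    using subprob_measurableD(2)[OF \<kappa>_kernel] by simp
  have "(\<integral>x. h (p x) * g x \<partial>\<mu>) = (\<integral>\<sigma>. (\<integral>x. h (p x) * g x \<partial>\<kappa> \<sigma>) \<partial>distr \<mu> borel p)"
  proof (rule integral_disintegration[OF \<mu> p \<kappa>, symmetric])
    show "\<bar>h (p x) * g x\<bar> \<le> B' * B" for x
      unfolding abs_mult using g(2)[of x] h(2)[of "p x"] by (intro mult_mono) auto
  qed measurable
  also have "\<dots> = (\<integral>\<sigma>. h \<sigma> * (\<integral>x. g x \<partial>\<kappa> \<sigma>) \<partial>distr \<mu> borel p)"
  proof (rule integral_cong_AE)
    show "AE \<sigma> in distr \<mu> borel p. (\<integral>x. h (p x) * g x \<partial>\<kappa> \<sigma>) = h \<sigma> * (\<integral>x. g x \<partial>\<kappa> \<sigma>)"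
    proof (rule AE_mp)
      show "AE \<sigma> in distr \<mu> borel p. AE x in \<kappa> \<sigma>. x \<in> p -` {\<sigma>}"
        using \<kappa> by (simp add: disintegration_def)
      show "AE \<sigma> in distr \<mu> borel p. (AE x in \<kappa> \<sigma>. x \<in> p -` {\<sigma>}) \<longrightarrow>
          (\<integral>x. h (p x) * g x \<partial>\<kappa> \<sigma>) = h \<sigma> * (\<integral>x. g x \<partial>\<kappa> \<sigma>)"
      proof (intro AE_I2 impI)
        fix \<sigma> assume *: "AE x in \<kappa> \<sigma>. x \<in> p -` {\<sigma>}"
        have m: "borel_measurable (\<kappa> \<sigma>) = borel_measurable borel"
          using sets_\<kappa> by (rule measurable_cong_sets) simp
        have "(\<integral>x. h (p x) * g x \<partial>\<kappa> \<sigma>) = (\<integral>x. h \<sigma> * g x \<partial>\<kappa> \<sigma>)"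
        proof (rule integral_cong_AE)
          show "AE x in \<kappa> \<sigma>. h (p x) * g x = h \<sigma> * g x" using * by eventually_elim auto
        qed (unfold m, measurable)
        then show "(\<integral>x. h (p x) * g x \<partial>\<kappa> \<sigma>) = h \<sigma> * (\<integral>x. g x \<partial>\<kappa> \<sigma>)" by simp
      qed
    qed
  qed measurable
  finally show ?thesis by simp
qed

text \<open>Truncated multiples of the distance approximate the indicator function of a closed set, so \<open>g\<close>
has integral \<open>0\<close> over closed sets. These generate the Borel sets and are stable under
intersection.\<close>

lemma AE_zero_if_lipschitz_integrals_zero:
  fixes g :: "'a::metric_space \<Rightarrow> real"
  assumes \<nu>: "sets \<nu> = sets borel" and g: "integrable \<nu> g"
    and zero: "\<And>h L. 0 < L \<Longrightarrow> L-lipschitz_on UNIV h \<Longrightarrow> (\<And>x. \<bar>h x\<bar> \<le> 1) \<Longrightarrow> (\<integral>x. h x * g x \<partial>\<nu>) = 0"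
  shows "AE x in \<nu>. g x = 0"
proof -
  have [measurable]: "g \<in> borel_measurable borel"
    using g \<nu> by (auto dest: borel_measurable_integrable cong: measurable_cong_sets)
  have m: "borel_measurable \<nu> = (borel_measurable borel :: ('a \<Rightarrow> real) set)"
    using \<nu> by (rule measurable_cong_sets) simp
  have set_int: "set_integrable \<nu> A g" if "A \<in> sets borel" for A
    using g that \<nu> unfolding set_integrable_def by (intro integrable_mult_indicator) auto
  have closed_zero: "(LINT x:F|\<nu>. g x) = 0" if F: "closed F" for F
  proof (cases "F = {}")
    case False
    have [measurable]: "F \<in> sets borel" using F by simp
    define h where "h k x = max 0 (1 - real (Suc k) * infdist x F)" for k x
    have lip: "(real (Suc k))-lipschitz_on UNIV (h k)" for k
    proof (rule lipschitz_onI)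
      fix x y
      have "\<bar>h k x - h k y\<bar> \<le> \<bar>real (Suc k) * infdist x F - real (Suc k) * infdist y F\<bar>"
        unfolding h_def by linarith
      also have "\<dots> = real (Suc k) * \<bar>infdist x F - infdist y F\<bar>"
        by (simp only: right_diff_distrib[symmetric] abs_mult abs_of_nat)
      also have "\<dots> \<le> real (Suc k) * dist x y"
        by (intro mult_left_mono infdist_triangle_abs) simp
      finally show "dist (h k x) (h k y) \<le> real (Suc k) * dist x y" by (simp add: dist_real_def)
    qed simp
    have bound: "\<bar>h k x\<bar> \<le> 1" for k x
      using infdist_nonneg[of x F] by (auto simp: h_def max_def)
    have [measurable]: "h k \<in> borel_measurable borel" for k
      using lipschitz_on_continuous_on[OF lip] by (rule borel_measurable_continuous_onI)
    have lim: "(\<lambda>k. h k x) \<longlonglongrightarrow> indicator F x" for x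
    proof (cases "x \<in> F")
      case True
      then show ?thesis by (simp add: h_def)
    next
      case False
      then have pos: "0 < infdist x F" using F \<open>F \<noteq> {}\<close> by (intro infdist_pos_not_in_closed)
      obtain N where N: "1 / infdist x F < real N" using reals_Archimedean2 by blast
      have "h k x = 0" if "N \<le> k" for k
      proof -
        have "1 / infdist x F \<le> real (Suc k)" using N that by linarith
        then show ?thesis using pos by (simp add: h_def field_simps)
      qed
      then have "\<forall>\<^sub>F k in sequentially. h k x = indicator F x"
        using False by (auto simp: eventually_sequentially)
      then show ?thesis by (rule tendsto_eventually)
    qed
    have "(\<lambda>k. \<integral>x. h k x * g x \<partial>\<nu>) \<longlonglongrightarrow> (\<integral>x. indicator F x * g x \<partial>\<nu>)"
    proof (rule integral_dominated_convergence[where w = "\<lambda>x. \<bar>g x\<bar>"])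
      show "AE x in \<nu>. (\<lambda>k. h k x * g x) \<longlonglongrightarrow> indicator F x * g x"
        using lim by (intro AE_I2 tendsto_mult tendsto_const)
      show "AE x in \<nu>. norm (h k x * g x) \<le> \<bar>g x\<bar>" for k
        using bound[of k] by (intro AE_I2) (auto simp: abs_mult intro: mult_left_le_one_le)
      show "integrable \<nu> (\<lambda>x. \<bar>g x\<bar>)" using g by simp
      show "(\<lambda>x. indicator F x * g x) \<in> borel_measurable \<nu>" unfolding m by measurable
      show "(\<lambda>x. h k x * g x) \<in> borel_measurable \<nu>" for k unfolding m by measurable
    qed
    moreover have "(\<integral>x. h k x * g x \<partial>\<nu>) = 0" for k
      using lip bound by (intro zero[of "real (Suc k)"]) auto
    ultimately have "(\<lambda>k::nat. 0) \<longlonglongrightarrow> (\<integral>x. indicator F x * g x \<partial>\<nu>)" by simp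
    then have "(\<integral>x. indicator F x * g x \<partial>\<nu>) = 0" using LIMSEQ_unique tendsto_const by blast
    then show ?thesis by (simp add: set_lebesgue_integral_def)
  qed (simp add: set_lebesgue_integral_def)
  have borel_zero: "(LINT x:A|\<nu>. g x) = 0" if A: "A \<in> sets borel" for A
  proof -
    have borel: "sets borel = sigma_sets UNIV (Collect (closed :: 'a set \<Rightarrow> bool))"
      by (simp add: borel_eq_closed)
    have "Int_stable (Collect (closed :: 'a set \<Rightarrow> bool))" by (auto simp: Int_stable_def)
    from this subset_UNIV[of "Collect closed", folded Pow_UNIV] A[unfolded borel] show ?thesis
    proof (induction rule: sigma_sets_induct_disjoint)
      case (basic A)
      then show ?case using closed_zero by simp
    next
      case (compl A)
      then have "A \<in> sets borel" "UNIV - A \<in> sets borel"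
        unfolding borel[symmetric] by (simp_all add: sets.Diff)
      then have "(LINT x:A \<union> (UNIV - A)|\<nu>. g x) = (LINT x:A|\<nu>. g x) + (LINT x:UNIV - A|\<nu>. g x)"
        by (intro set_integral_Un set_int) auto
      then show ?case using compl(2) closed_zero[of UNIV] by simp
    next
      case (union A)
      then have A: "A i \<in> sets borel" for i unfolding borel by blast
      have "(LINT x:(\<Union>i. A i)|\<nu>. g x) = (\<Sum>i. (LINT x:A i|\<nu>. g x))"
      proof (rule lebesgue_integral_countable_add)
        show "A i \<in> sets \<nu>" for i using A \<nu> by simp
        show "A i \<inter> A j = {}" if "i \<noteq> j" for i j
          using union(1) that by (auto simp: disjoint_family_on_def)
        show "set_integrable \<nu> (\<Union>i. A i) g" using A by (intro set_int) blast
      qed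
      then show ?case using union by simp
    qed (simp add: set_lebesgue_integral_def)
  qed
  show ?thesis
  proof (rule density_unique_real)
    fix A assume "A \<in> sets \<nu>"
    then show "(LINT x:A|\<nu>. g x) = (LINT x:A|\<nu>. 0)"
      using borel_zero \<nu> by (simp add: set_lebesgue_integral_def)
  qed (use g in auto)
qed

lemma exists_lipschitz_test_function:
  fixes g :: "'a::metric_space \<Rightarrow> real"
  assumes \<nu>: "sets \<nu> = sets borel" and g: "integrable \<nu> g" and "\<not> (AE x in \<nu>. g x = 0)"
  obtains h L where "0 < L" "L-lipschitz_on UNIV h" "\<And>x. \<bar>h x\<bar> \<le> 1" "0 < (\<integral>x. h x * g x \<partial>\<nu>)"
proof -
  obtain h L where h: "0 < L" "L-lipschitz_on UNIV h" "\<And>x. \<bar>h x\<bar> \<le> 1" "(\<integral>x. h x * g x \<partial>\<nu>) \<noteq> 0"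
    using AE_zero_if_lipschitz_integrals_zero[OF \<nu> g] assms(3) by metis
  show thesis
  proof (cases "0 < (\<integral>x. h x * g x \<partial>\<nu>)")
    case True
    then show thesis using h that by blast
  next
    case False
    moreover have "L-lipschitz_on UNIV (\<lambda>x. - h x)"
      using h(2) by (simp add: lipschitz_on_def dist_minus)
    ultimately show thesis using h by (intro that[of L "\<lambda>x. - h x"]) auto
  qed
qed

section \<open>First variation of the cost\<close>

lemma deriv_halfline_continuous:
  assumes "C1_halfline \<phi>"
  shows "continuous_on {0..} (deriv_halfline \<phi>)"
proof -
  obtain L where L: "(deriv \<phi> \<longlongrightarrow> L) (at_right 0)" and c: "continuous_on {0<..} (deriv \<phi>)"
    using assms by (auto simp: C1_halfline_def)
  have d0: "deriv_halfline \<phi> 0 = L"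
    using tendsto_Lim[OF _ L] by (simp add: deriv_halfline_def)
  show ?thesis
    unfolding continuous_on_def
  proof
    fix t :: real assume "t \<in> {0..}"
    then consider "t = 0" | "0 < t" by force
    then show "(deriv_halfline \<phi> \<longlongrightarrow> deriv_halfline \<phi> t) (at t within {0..})"
    proof cases
      case 1
      have "(deriv_halfline \<phi> \<longlongrightarrow> L) (at_right 0)"
        using L by (rule Lim_transform_eventually)
           (auto simp: eventually_at_filter deriv_halfline_def)
      then show ?thesis
        unfolding 1 d0 by (simp add: at_within_Ici_at_right)
    next
      case 2
      have "(deriv \<phi> \<longlongrightarrow> deriv \<phi> t) (at t)"
        using c 2 by (simp add: continuous_on_eq_continuous_at continuous_at)
      moreover have "\<forall>\<^sub>F u in at t. deriv \<phi> u = deriv_halfline \<phi> u"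
        using eventually_at_topological[of "\<lambda>u. deriv \<phi> u = deriv_halfline \<phi> u" t UNIV] 2
        by (auto simp: deriv_halfline_def intro!: exI[of _ "{0<..}"])
      ultimately have "(deriv_halfline \<phi> \<longlongrightarrow> deriv \<phi> t) (at t)"
        by (rule Lim_transform_eventually)
      then show ?thesis
        using 2 by (auto simp: deriv_halfline_def intro: tendsto_within_subset)
    qed
  qed
qed

text \<open>The function is constant on the negative half-line, so it is continuous on the whole line.\<close>

lemma deriv_halfline_measurable:
  assumes "C1_halfline \<phi>" shows "deriv_halfline \<phi> \<in> borel_measurable borel"
proof -
  have "continuous_on UNIV (\<lambda>t. deriv_halfline \<phi> (max 0 t))"
    by (rule continuous_on_compose2[OF deriv_halfline_continuous[OF assms]])
       (auto intro!: continuous_intros)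
  moreover have "deriv_halfline \<phi> (max 0 t) = deriv_halfline \<phi> t" for t
    by (auto simp: deriv_halfline_def max_def)
  ultimately show ?thesis by (simp add: borel_measurable_continuous_onI)
qed

lemma deriv_halfline_bounded:
  assumes "C1_halfline \<phi>"
  obtains M where "0 < M" "\<And>t. 0 \<le> t \<Longrightarrow> t \<le> R \<Longrightarrow> \<bar>deriv_halfline \<phi> t\<bar> \<le> M"
proof -
  have "compact (deriv_halfline \<phi> ` {0..R})"
    by (rule compact_continuous_image[OF continuous_on_subset[OF deriv_halfline_continuous[OF assms]]]) auto
  then obtain M where M: "0 < M" "\<And>y. y \<in> deriv_halfline \<phi> ` {0..R} \<Longrightarrow> norm y \<le> M"
    using compact_imp_bounded bounded_pos by metis
  then show thesis using that[of M] by auto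
qed

lemma C1_halfline_lipschitz:
  assumes \<phi>: "C1_halfline \<phi>"
    and M: "\<And>t. 0 \<le> t \<Longrightarrow> t \<le> R \<Longrightarrow> \<bar>deriv_halfline \<phi> t\<bar> \<le> M"
    and ab: "a \<in> {0..R}" "b \<in> {0..R}"
  shows "\<bar>\<phi> a - \<phi> b\<bar> \<le> M * \<bar>a - b\<bar>"
  using ab
proof (induction a b rule: linorder_wlog)
  case (le a b)
  show ?case
  proof (cases "a = b")
    case False
    then have "a < b" using le by simp
    have diff: "(\<phi> has_derivative (\<lambda>h. h * deriv \<phi> t)) (at t)" if "a < t" "t < b" for t
    proof -
      have "\<phi> differentiable (at t)" using \<phi> that le by (auto simp: C1_halfline_def)
      then have "(\<phi> has_real_derivative deriv \<phi> t) (at t)"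
        using DERIV_deriv_iff_real_differentiable by blast
      then show ?thesis by (simp add: has_field_derivative_def mult_commute_abs)
    qed
    have "continuous_on {a..b} \<phi>"
      using \<phi> le by (auto simp: C1_halfline_def intro: continuous_on_subset)
    then obtain t where t: "a < t" "t < b" "\<phi> b - \<phi> a = (b - a) * deriv \<phi> t"
      using mvt[OF \<open>a < b\<close> _ diff] by auto
    have "\<bar>deriv \<phi> t\<bar> \<le> M" using M[of t] t le by (simp add: deriv_halfline_def)
    then have "\<bar>\<phi> b - \<phi> a\<bar> \<le> (b - a) * M"
      using t \<open>a < b\<close> by (simp add: abs_mult)
    then show ?thesis using \<open>a < b\<close> by (simp add: abs_minus_commute mult.commute)
  qed simp
next
  case (sym a b)
  then show ?case by (simp add: abs_minus_commute)
qed

lemma C1_halfline_measurable_comp: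
  assumes "C1_halfline \<phi>" "f \<in> borel_measurable M" "\<And>x. 0 \<le> f x"
  shows "(\<lambda>x. \<phi> (f x)) \<in> borel_measurable M"
proof -
  have "continuous_on {0..} \<phi>" using assms(1) by (simp add: C1_halfline_def)
  then have "continuous_on UNIV (\<lambda>t. \<phi> (max 0 t))"
    by (rule continuous_on_compose2) (auto intro!: continuous_intros)
  from measurable_compose[OF assms(2) borel_measurable_continuous_onI[OF this]]
  show ?thesis using assms(3) by (simp add: max_absorb2)
qed

lemma has_derivative_norm_comp:
  fixes v :: "'a::real_inner"
  assumes "C1_halfline \<phi>" "v \<noteq> 0"
  shows "((\<lambda>w. \<phi> (norm w)) has_derivative (\<lambda>w. deriv_halfline \<phi> (norm v) * (sgn v \<bullet> w))) (at v)"
proof -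
  have "\<phi> differentiable (at (norm v))" using assms by (auto simp: C1_halfline_def)
  then have "(\<phi> has_derivative (*) (deriv \<phi> (norm v))) (at (norm v))"
    using DERIV_deriv_iff_real_differentiable by (simp add: has_field_derivative_def)
  from has_derivative_compose[OF has_derivative_norm[OF assms(2)] this] show ?thesis
    using assms(2) by (simp add: deriv_halfline_def inner_commute)
qed

lemma has_derivative_sequential_quotient:
  fixes g :: "'a::real_normed_vector \<Rightarrow> real"
  assumes g: "(g has_derivative D) (at v)"
    and s: "\<And>n. 0 < s n" "s \<longlonglongrightarrow> 0" and z: "z \<longlonglongrightarrow> z0"
  shows "(\<lambda>n. (g (v + s n *\<^sub>R z n) - g v) / s n) \<longlonglongrightarrow> D z0"
proof -
  interpret D: bounded_linear D using g by (rule has_derivative_bounded_linear)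
  define r where "r w = (g (v + w) - g v - D w) / norm w" for w
  have "((\<lambda>w. norm (g (v + w) - g v - D w) / norm w) \<longlongrightarrow> 0) (at 0)"
    using g by (simp add: has_derivative_at)
  then have "((\<lambda>w. norm (r w)) \<longlongrightarrow> 0) (at 0)" by (simp add: r_def abs_divide)
  then have "(r \<longlongrightarrow> 0) (at 0)" by (rule tendsto_norm_zero_cancel)
  moreover have "r 0 = 0" by (simp add: r_def)
  ultimately have "isCont r 0" by (simp add: isCont_def)
  moreover have "(\<lambda>n. s n *\<^sub>R z n) \<longlonglongrightarrow> 0" using tendsto_scaleR[OF s(2) z] by simp
  ultimately have "(\<lambda>n. r (s n *\<^sub>R z n)) \<longlonglongrightarrow> r 0" by (rule isCont_tendsto_compose)
  then have r: "(\<lambda>n. r (s n *\<^sub>R z n)) \<longlonglongrightarrow> 0" using \<open>r 0 = 0\<close> by simp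
  have eq: "(g (v + s n *\<^sub>R z n) - g v) / s n = D (z n) + r (s n *\<^sub>R z n) * norm (z n)" for n
  proof (cases "z n = 0")
    case False
    then show ?thesis using s(1)[of n]
      by (simp add: r_def D.scaleR field_simps)
  qed (simp add: D.zero)
  have "(\<lambda>n. D (z n) + r (s n *\<^sub>R z n) * norm (z n)) \<longlonglongrightarrow> D z0 + 0 * norm z0"
    by (intro tendsto_intros r z D.tendsto)
  then show ?thesis by (simp add: eq)
qed

text \<open>The cost \<open>\<phi> (norm v)\<close> is differentiable away from \<open>v = 0\<close> and Lipschitz on bounded sets. So the
difference quotients converge almost everywhere and are bounded by a constant, also when the
directions \<open>y n\<close> vary with \<open>n\<close>.\<close>

lemma first_variation_limit:
  fixes V :: "'b \<Rightarrow> 'a::euclidean_space" and y :: "nat \<Rightarrow> 'b \<Rightarrow> 'a"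
  assumes \<phi>: "C1_halfline \<phi>" and "finite_measure \<mu>"
    and V: "V \<in> borel_measurable \<mu>" "AE x in \<mu>. norm (V x) \<le> R" "AE x in \<mu>. V x \<noteq> 0"
    and y: "\<And>n. y n \<in> borel_measurable \<mu>" "\<And>n x. norm (y n x) \<le> B" "\<And>x. (\<lambda>n. y n x) \<longlonglongrightarrow> Y x"
    and s: "\<And>n. 0 < s n" "\<And>n. s n \<le> 1" "s \<longlonglongrightarrow> 0"
  shows "(\<lambda>n. \<integral>x. (\<phi> (norm (V x - s n *\<^sub>R y n x)) - \<phi> (norm (V x))) / s n \<partial>\<mu>)
      \<longlonglongrightarrow> - (\<integral>x. deriv_halfline \<phi> (norm (V x)) * (sgn (V x) \<bullet> Y x) \<partial>\<mu>)"
proof -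
  interpret finite_measure \<mu> by fact
  obtain M where M: "0 < M" "\<And>t. 0 \<le> t \<Longrightarrow> t \<le> R + B \<Longrightarrow> \<bar>deriv_halfline \<phi> t\<bar> \<le> M"
    using deriv_halfline_bounded[OF \<phi>, of "R + B"] by blast
  note [measurable] = V(1) y(1) deriv_halfline_measurable[OF \<phi>]
  have [measurable]: "Y \<in> borel_measurable \<mu>"
    using y(1,3) by (rule borel_measurable_LIMSEQ_metric)
  have "0 \<le> B" using y(2) norm_ge_zero order_trans by blast
  have "(\<lambda>n. \<integral>x. (\<phi> (norm (V x - s n *\<^sub>R y n x)) - \<phi> (norm (V x))) / s n \<partial>\<mu>)
      \<longlonglongrightarrow> (\<integral>x. deriv_halfline \<phi> (norm (V x)) * (sgn (V x) \<bullet> (- Y x)) \<partial>\<mu>)"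
  proof (rule integral_dominated_convergence[where w = "\<lambda>x. M * B"])
    show "(\<lambda>x. (\<phi> (norm (V x - s n *\<^sub>R y n x)) - \<phi> (norm (V x))) / s n) \<in> borel_measurable \<mu>" for n
      using C1_halfline_measurable_comp[OF \<phi>, of "\<lambda>x. norm (V x - s n *\<^sub>R y n x)" \<mu>]
        C1_halfline_measurable_comp[OF \<phi>, of "\<lambda>x. norm (V x)" \<mu>] by measurable
    show "(\<lambda>x. deriv_halfline \<phi> (norm (V x)) * (sgn (V x) \<bullet> (- Y x))) \<in> borel_measurable \<mu>"
      unfolding sgn_div_norm by measurable
    show "AE x in \<mu>. (\<lambda>n. (\<phi> (norm (V x - s n *\<^sub>R y n x)) - \<phi> (norm (V x))) / s n)
        \<longlonglongrightarrow> deriv_halfline \<phi> (norm (V x)) * (sgn (V x) \<bullet> (- Y x))"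
      using V(3)
    proof eventually_elim
      case (elim x)
      have "(\<lambda>n. - y n x) \<longlonglongrightarrow> - Y x" using y(3) by (rule tendsto_minus)
      from has_derivative_sequential_quotient[OF has_derivative_norm_comp[OF \<phi> elim] s(1,3) this]
      show ?case by simp
    qed
    show "AE x in \<mu>. norm ((\<phi> (norm (V x - s n *\<^sub>R y n x)) - \<phi> (norm (V x))) / s n) \<le> M * B" for n
      using V(2)
    proof eventually_elim
      case (elim x)
      have sy: "norm (s n *\<^sub>R y n x) \<le> s n * B" "s n * B \<le> B"
        using s(1,2)[of n] y(2)[of n x] \<open>0 \<le> B\<close> by (auto simp: mult_left_le_one_le intro!: mult_left_mono)
      have "norm (V x - s n *\<^sub>R y n x) \<le> R + B"
        using norm_triangle_ineq4[of "V x" "s n *\<^sub>R y n x"] elim sy by linarith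
      then have "\<bar>\<phi> (norm (V x - s n *\<^sub>R y n x)) - \<phi> (norm (V x))\<bar>
          \<le> M * \<bar>norm (V x - s n *\<^sub>R y n x) - norm (V x)\<bar>"
        using elim \<open>0 \<le> B\<close> by (intro C1_halfline_lipschitz[OF \<phi> M(2), of "R + B"]) auto
      also have "\<dots> \<le> M * (s n * B)"
        using M(1) sy norm_triangle_ineq3[of "V x - s n *\<^sub>R y n x" "V x"] by (intro mult_left_mono) auto
      finally show ?case using s(1)[of n] by (simp add: abs_divide divide_le_eq mult_ac)
    qed
  qed (simp)
  then show ?thesis by simp
qed

section \<open>Admissible perturbations at a noncut point\<close>

text \<open>The map has Lipschitz constant \<open>1 + s / (2 l)\<close> and \<open>T\<close> has length at most \<open>l - s / 2\<close>; the
product is \<open>l - s^2 / (4 l)\<close>.\<close>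

lemma lipschitz_perturbation_admissible:
  fixes T :: "'a::real_normed_vector set"
  assumes T: "T \<noteq> {}" "compact T" "connected T" "hausdorff1 T + ennreal (s / 2) \<le> ennreal l"
    and \<xi>: "L-lipschitz_on UNIV \<xi>" and "0 < L" "0 < l" "0 < s"
  shows "(\<lambda>z. z + (s / (2 * L * l)) *\<^sub>R \<xi> z) ` T \<in> admissible l"
proof -
  let ?t = "s / (2 * L * l)"
  let ?F = "\<lambda>z. z + ?t *\<^sub>R \<xi> z"
  have lip: "(1 + s / (2 * l))-lipschitz_on UNIV ?F"
  proof (rule lipschitz_onI)
    fix x y :: 'a
    have "dist (?F x) (?F y) = norm ((x - y) + ?t *\<^sub>R (\<xi> x - \<xi> y))"
      by (simp add: dist_norm algebra_simps)
    also have "\<dots> \<le> norm (x - y) + ?t * norm (\<xi> x - \<xi> y)"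
      using norm_triangle_ineq[of "x - y" "?t *\<^sub>R (\<xi> x - \<xi> y)"] \<open>0 < L\<close> \<open>0 < l\<close> \<open>0 < s\<close> by simp
    also have "\<dots> \<le> norm (x - y) + ?t * (L * norm (x - y))"
      using lipschitz_on_normD[OF \<xi>, of x y] \<open>0 < L\<close> \<open>0 < l\<close> \<open>0 < s\<close>
      by (intro add_left_mono mult_left_mono) auto
    also have "\<dots> = (1 + s / (2 * l)) * dist x y"
      using \<open>0 < L\<close> by (simp add: dist_norm field_simps)
    finally show "dist (?F x) (?F y) \<le> (1 + s / (2 * l)) * dist x y" .
  qed (use \<open>0 < l\<close> \<open>0 < s\<close> in auto)
  have cont: "continuous_on T ?F"
    using lipschitz_on_continuous_on[OF lip] by (rule continuous_on_subset) simp
  have "hausdorff1 T \<noteq> \<top>"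
  proof
    assume "hausdorff1 T = \<top>"
    then show False using T(4) by (simp add: top_unique)
  qed
  then obtain c where c: "0 \<le> c" "hausdorff1 T = ennreal c"
    by (cases "hausdorff1 T") auto
  have "c + s / 2 \<le> l"
    using T(4) c \<open>0 < l\<close> \<open>0 < s\<close> by (simp flip: ennreal_plus)
  have "hausdorff1 (?F ` T) \<le> ennreal (1 + s / (2 * l)) * hausdorff1 T"
    using \<open>0 < l\<close> \<open>0 < s\<close>
    by (intro hausdorff1_lipschitz_image lipschitz_on_subset[OF lip]) (auto simp: add_pos_pos)
  also have "\<dots> = ennreal ((1 + s / (2 * l)) * c)"
    using c \<open>0 < l\<close> \<open>0 < s\<close> by (simp add: ennreal_mult')
  also have "\<dots> \<le> ennreal l"
  proof (rule ennreal_leI)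
    have "(1 + s / (2 * l)) * c \<le> (1 + s / (2 * l)) * (l - s / 2)"
      using \<open>c + s / 2 \<le> l\<close> \<open>0 < l\<close> \<open>0 < s\<close> by (intro mult_left_mono) auto
    also have "\<dots> = l - s\<^sup>2 / (4 * l)"
      using \<open>0 < l\<close> by (simp add: field_simps power2_eq_square)
    also have "\<dots> \<le> l" using \<open>0 < l\<close> by simp
    finally show "(1 + s / (2 * l)) * c \<le> l" .
  qed
  finally have "hausdorff1 (?F ` T) \<le> ennreal l" .
  then show ?thesis
    using T cont by (auto simp: admissible_def intro!: compact_continuous_image connected_continuous_image)
qed

lemma integrable_bounded_cost:
  assumes "finite_measure \<mu>" and \<phi>: "C1_halfline \<phi>" "\<phi> 0 = 0" "mono_on {0..} \<phi>"
    and f: "f \<in> borel_measurable \<mu>" "\<And>x. 0 \<le> f x" "AE x in \<mu>. f x \<le> R"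
  shows "integrable \<mu> (\<lambda>x. \<phi> (f x))"
proof -
  interpret finite_measure \<mu> by fact
  have "AE x in \<mu>. norm (\<phi> (f x)) \<le> \<phi> R"
    using f(3)
  proof eventually_elim
    case (elim x)
    then show ?case
      using mono_onD[OF \<phi>(3), of "f x" R] mono_onD[OF \<phi>(3), of 0 "f x"] f(2)[of x] \<phi>(2) by auto
  qed
  then show ?thesis
    using C1_halfline_measurable_comp[OF \<phi>(1) f(1,2)] by (rule integrable_const_bound)
qed

text \<open>This is the integrand of the barycentre. Moving the image point \<open>p x\<close> by a small vector \<open>w\<close>
changes the cost \<open>\<phi> (norm (x - p x))\<close> by \<open>- (cost_gradient \<phi> p x \<bullet> w)\<close> to first order.\<close>

definition cost_gradient :: "(real \<Rightarrow> real) \<Rightarrow> ('a::euclidean_space \<Rightarrow> 'a) \<Rightarrow> 'a \<Rightarrow> 'a" where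
  "cost_gradient \<phi> p x = deriv_halfline \<phi> (norm (x - p x)) *\<^sub>R sgn (x - p x)"

lemma cost_gradient_measurable:
  assumes "C1_halfline \<phi>" "p \<in> borel_measurable borel"
  shows "cost_gradient \<phi> p \<in> borel_measurable borel"
proof -
  note [measurable] = assms(2) deriv_halfline_measurable[OF assms(1)]
  show ?thesis unfolding cost_gradient_def[abs_def] sgn_div_norm by measurable
qed

lemma bounded_displacement_on_msupport:
  fixes \<mu> :: "'a::euclidean_space measure"
  assumes "compact (msupport \<mu>)" "compact S" "p \<in> closest_point_projections S"
  obtains R where "0 < R" "\<And>x. x \<in> msupport \<mu> \<Longrightarrow> norm (x - p x) \<le> R"
proof -
  obtain R1 R2 where R: "0 < R1" "0 < R2" "\<And>x. x \<in> msupport \<mu> \<Longrightarrow> norm x \<le> R1" "\<And>x. x \<in> S \<Longrightarrow> norm x \<le> R2"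
    using assms(1,2) compact_imp_bounded bounded_pos by metis
  show thesis
  proof (rule that[of "R1 + R2"])
    fix x assume "x \<in> msupport \<mu>"
    moreover have "p x \<in> S" using assms(3) by (simp add: closest_point_projections_def)
    ultimately have "norm x \<le> R1" "norm (p x) \<le> R2" using R(3,4) by blast+
    then show "norm (x - p x) \<le> R1 + R2" using norm_triangle_ineq4[of x "p x"] by linarith
  qed (use R in simp)
qed

lemma cost_gradient_bounded_on_msupport:
  fixes \<mu> :: "'a::euclidean_space measure"
  assumes "compact (msupport \<mu>)" "compact S" "p \<in> closest_point_projections S" "C1_halfline \<phi>"
  obtains M where "0 < M" "\<And>x. x \<in> msupport \<mu> \<Longrightarrow> norm (cost_gradient \<phi> p x) \<le> M"
proof -
  obtain R where R: "\<And>x. x \<in> msupport \<mu> \<Longrightarrow> norm (x - p x) \<le> R"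
    using bounded_displacement_on_msupport[OF assms(1-3)] by blast
  obtain M where M: "0 < M" "\<And>t. 0 \<le> t \<Longrightarrow> t \<le> R \<Longrightarrow> \<bar>deriv_halfline \<phi> t\<bar> \<le> M"
    using deriv_halfline_bounded[OF assms(4)] by blast
  show thesis
  proof (rule that[OF M(1)])
    fix x assume "x \<in> msupport \<mu>"
    then have "\<bar>deriv_halfline \<phi> (norm (x - p x))\<bar> \<le> M" using R M(2) by simp
    then show "norm (cost_gradient \<phi> p x) \<le> M"
      using M(1) by (simp add: cost_gradient_def norm_sgn)
  qed
qed

text \<open>Cuts that shrink to \<open>a\<close>, chosen so that the rescaled positions of the nearby points \<open>q n\<close>
converge: these points replace \<open>a\<close> as the image of the points projected to it.\<close>

lemma noncut_point_cut_sequence: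
  fixes S :: "'a::euclidean_space set"
  assumes S: "compact S" "connected S" "hausdorff1 S \<le> ennreal l"
    and a: "noncut_point S a" "S \<noteq> {a}"
  obtains T q s u where
    "\<And>n::nat. 0 < s n" "\<And>n. s n \<le> 1" "s \<longlonglongrightarrow> 0"
    "\<And>n. T n \<subseteq> S" "\<And>n. compact (T n)" "\<And>n. connected (T n)" "\<And>n. a \<notin> T n" "\<And>n. S - T n \<subseteq> cball a (s n)"
    "\<And>n. hausdorff1 (T n) + ennreal (s n / 2) \<le> hausdorff1 S"
    "\<And>n. q n \<in> T n" "\<And>n. dist (q n) a \<le> s n"
    "q \<longlonglongrightarrow> a" "(\<lambda>n. (1 / s n) *\<^sub>R (q n - a)) \<longlonglongrightarrow> u" "norm u \<le> 1"
proof -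
  have "\<exists>T q s. 0 < s \<and> s \<le> 1 / real (Suc n) \<and> T \<subseteq> S \<and> compact T \<and> connected T \<and> a \<notin> T \<and>
      q \<in> T \<and> dist q a \<le> s \<and> S - T \<subseteq> cball a s \<and> hausdorff1 T + ennreal (s / 2) \<le> hausdorff1 S" for n
    using cut_off_noncut_point[OF S a, of "1 / real (Suc n)"] by (metis of_nat_0_less_iff zero_less_Suc zero_less_divide_1_iff)
  then obtain T0 q0 s0 where cut0: "\<And>n. 0 < s0 n \<and> s0 n \<le> 1 / real (Suc n) \<and> T0 n \<subseteq> S \<and> compact (T0 n) \<and>
      connected (T0 n) \<and> a \<notin> T0 n \<and> q0 n \<in> T0 n \<and> dist (q0 n) a \<le> s0 n \<and> S - T0 n \<subseteq> cball a (s0 n) \<and>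
      hausdorff1 (T0 n) + ennreal (s0 n / 2) \<le> hausdorff1 S"
    by metis
  have "\<forall>n. (1 / s0 n) *\<^sub>R (q0 n - a) \<in> cball 0 1"
  proof
    fix n show "(1 / s0 n) *\<^sub>R (q0 n - a) \<in> cball 0 1"
      using cut0[of n] by (simp add: dist_norm)
  qed
  then obtain u r where r: "strict_mono (r :: nat \<Rightarrow> nat)" and u: "u \<in> cball 0 1"
    and u_lim0: "((\<lambda>n. (1 / s0 n) *\<^sub>R (q0 n - a)) \<circ> r) \<longlonglongrightarrow> u"
    by (rule seq_compactE[OF compact_imp_seq_compact[OF compact_cball]])
  define T where "T n = T0 (r n)" for n
  define q where "q n = q0 (r n)" for n
  define s where "s n = s0 (r n)" for n
  have cut: "0 < s n" "T n \<subseteq> S" "compact (T n)" "connected (T n)" "a \<notin> T n" "q n \<in> T n"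
    "dist (q n) a \<le> s n" "S - T n \<subseteq> cball a (s n)" "hausdorff1 (T n) + ennreal (s n / 2) \<le> hausdorff1 S" for n
    using cut0[of "r n"] by (auto simp: T_def q_def s_def)
  have s_le: "s n \<le> 1 / real (Suc n)" for n
  proof -
    have "s n \<le> 1 / real (Suc (r n))" using cut0[of "r n"] by (simp add: s_def)
    also have "\<dots> \<le> 1 / real (Suc n)"
      using seq_suble[OF r, of n] by (intro divide_left_mono) auto
    finally show ?thesis .
  qed
  have s_1: "s n \<le> 1" for n using s_le[of n] by (rule order_trans) (simp add: divide_le_eq)
  have s_0: "s \<longlonglongrightarrow> 0"
  proof (rule tendsto_sandwich[OF _ _ tendsto_const LIMSEQ_inverse_real_of_nat])
    show "\<forall>\<^sub>F n in sequentially. 0 \<le> s n" using cut(1) by (simp add: less_imp_le)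
    show "\<forall>\<^sub>F n in sequentially. s n \<le> inverse (real (Suc n))"
      using s_le by (simp add: inverse_eq_divide)
  qed
  have u_lim: "(\<lambda>n. (1 / s n) *\<^sub>R (q n - a)) \<longlonglongrightarrow> u"
    using u_lim0 by (simp add: s_def q_def o_def)
  have q_lim: "q \<longlonglongrightarrow> a"
    using cut(7) by (intro metric_tendsto_imp_tendsto[OF s_0]) (auto simp: cut(1) less_imp_le)
  show thesis
    using that[OF cut(1) s_1 s_0 cut(2-5,8,9,6,7) q_lim u_lim] u by simp
qed

text \<open>Cutting at scale \<open>s n\<close> and moving the rest along \<open>\<xi>\<close> gives an admissible competitor. Its cost is
compared with that of \<open>S\<close> through an explicit choice of image points: \<open>x\<close> is sent to the moved
copy of \<open>p x\<close> if \<open>p x\<close> survives the cut, and to the moved copy of \<open>q n\<close> otherwise. Both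
displacements are of order \<open>s n\<close>.\<close>

lemma noncut_point_variation:
  fixes \<mu> :: "'a::euclidean_space measure"
  assumes \<mu>: "prob_space \<mu>" "sets \<mu> = sets borel" "compact (msupport \<mu>)"
    and \<phi>: "\<phi> 0 = 0" "C1_halfline \<phi>" "mono_on {0..} \<phi>"
    and "emeasure \<mu> S = 0" and "0 < l" and S: "S \<in> admissible l"
    and minimal: "\<And>T. T \<in> admissible l \<Longrightarrow> objective \<phi> \<mu> S \<le> objective \<phi> \<mu> T"
    and p: "p \<in> closest_point_projections S"
    and a: "noncut_point S a" "S \<noteq> {a}"
    and \<xi>: "0 < L" "L-lipschitz_on UNIV \<xi>" "\<And>z. norm (\<xi> z) \<le> 1"
  shows "(\<integral>x. cost_gradient \<phi> p x \<bullet> \<xi> (p x) \<partial>\<mu>)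
    \<le> 2 * L * l * norm (\<integral>x. indicator {a} (p x) *\<^sub>R cost_gradient \<phi> p x \<partial>\<mu>)"
proof -
  interpret prob_space \<mu> by fact
  have S': "compact S" "connected S" "hausdorff1 S \<le> ennreal l"
    using S by (auto simp: admissible_def)
  have pS: "p x \<in> S" and p_dist: "norm (x - p x) = infdist x S" for x
    using p by (auto simp: closest_point_projections_def dist_norm)
  have p_borel[measurable]: "p \<in> borel_measurable borel"
    using p by (simp add: closest_point_projections_def)
  have meas: "borel_measurable \<mu> = (borel_measurable borel :: ('a \<Rightarrow> 'c::topological_space) set)"
    using \<mu>(2) by (rule measurable_cong_sets) simp
  have [measurable]: "\<xi> \<in> borel_measurable borel"
    using lipschitz_on_continuous_on[OF \<xi>(2)] by (rule borel_measurable_continuous_onI)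
  define c where "c = 1 / (2 * L * l)"
  have "0 < c" using \<xi>(1) \<open>0 < l\<close> by (simp add: c_def)
  obtain T q s u where s: "\<And>n::nat. 0 < s n" "\<And>n. s n \<le> 1" "s \<longlonglongrightarrow> 0"
    and T: "\<And>n. T n \<subseteq> S" "\<And>n. compact (T n)" "\<And>n. connected (T n)" "\<And>n. a \<notin> T n"
      "\<And>n. S - T n \<subseteq> cball a (s n)" "\<And>n. hausdorff1 (T n) + ennreal (s n / 2) \<le> hausdorff1 S"
    and q: "\<And>n. q n \<in> T n" "\<And>n. dist (q n) a \<le> s n" "q \<longlonglongrightarrow> a"
    and u: "(\<lambda>n. (1 / s n) *\<^sub>R (q n - a)) \<longlonglongrightarrow> u" "norm u \<le> 1"
    by (rule noncut_point_cut_sequence[OF S' a], rule that)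
  \<comment> \<open>The displacement of the image point of \<open>x\<close>, divided by \<open>s n\<close>, and its limit.\<close>
  define y where "y n x = (if p x \<in> T n then c *\<^sub>R \<xi> (p x)
    else (1 / s n) *\<^sub>R (q n - p x) + c *\<^sub>R \<xi> (q n))" for n x
  define Y where "Y x = c *\<^sub>R \<xi> (p x) + indicator {a} (p x) *\<^sub>R u" for x
  define V where "V x = x - p x" for x
  have c\<xi>: "norm (c *\<^sub>R \<xi> z) \<le> c" for z
    using \<xi>(3)[of z] \<open>0 < c\<close> by (simp add: mult_left_le)
  have y_bound: "norm (y n x) \<le> 2 + c" for n x
  proof (cases "p x \<in> T n")
    case True
    then show ?thesis using c\<xi>[of "p x"] unfolding y_def by simp
  next
    case False
    then have "p x \<in> cball a (s n)" using T(5)[of n] pS[of x] by blast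
    then have "dist a (p x) \<le> s n" by simp
    then have "norm (q n - p x) \<le> 2 * s n"
      using q(2)[of n] dist_triangle[of "q n" "p x" a] by (simp add: dist_norm)
    then have "norm ((1 / s n) *\<^sub>R (q n - p x)) \<le> 2"
      using s(1)[of n] by (simp only: norm_scaleR abs_of_pos zero_less_divide_1_iff) (simp add: divide_le_eq)
    then have "norm ((1 / s n) *\<^sub>R (q n - p x) + c *\<^sub>R \<xi> (q n)) \<le> 2 + c"
      using c\<xi> by (rule norm_add_rule_thm)
    then show ?thesis using False by (simp add: y_def)
  qed
  have y_lim: "(\<lambda>n. y n x) \<longlonglongrightarrow> Y x" for x
  proof (cases "p x = a")
    case True
    have "isCont \<xi> a"
      using lipschitz_on_continuous_on[OF \<xi>(2)] by (simp add: continuous_on_eq_continuous_at)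
    then have "(\<lambda>n. \<xi> (q n)) \<longlonglongrightarrow> \<xi> a" using q(3) by (rule isCont_tendsto_compose)
    then have "(\<lambda>n. (1 / s n) *\<^sub>R (q n - a) + c *\<^sub>R \<xi> (q n)) \<longlonglongrightarrow> u + c *\<^sub>R \<xi> a"
      by (intro tendsto_intros u(1))
    then show ?thesis using True T(4) by (simp add: y_def Y_def add.commute)
  next
    case False
    then have "\<forall>\<^sub>F n in sequentially. s n < dist a (p x)"
      using s(3) by (intro order_tendstoD(2)) auto
    then have "\<forall>\<^sub>F n in sequentially. y n x = Y x"
    proof eventually_elim
      case (elim n)
      then have "p x \<notin> cball a (s n)" by simp
      then have "p x \<in> T n" using T(5)[of n] pS[of x] by blast
      then show ?case using False by (simp add: y_def Y_def)
    qed
    then show ?thesis by (rule tendsto_eventually)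
  qed
  have [measurable]: "T n \<in> sets borel" for n
    using T(2) by (rule borel_compact)
  have y_meas: "y n \<in> borel_measurable \<mu>" for n unfolding meas y_def by measurable
  have V_meas: "V \<in> borel_measurable \<mu>" unfolding meas V_def by measurable
  obtain R where R: "0 < R" "\<And>x. x \<in> msupport \<mu> \<Longrightarrow> norm (x - p x) \<le> R"
    using bounded_displacement_on_msupport[OF \<mu>(3) S'(1) p] by blast
  have V_R: "AE x in \<mu>. norm (V x) \<le> R"
    using AE_in_msupport[OF \<mu>(2)] by eventually_elim (simp add: V_def R(2))
  have "S \<in> null_sets \<mu>"
    using assms(7) S'(1) \<mu>(2) by (auto simp: null_sets_def intro: borel_compact)
  then have "AE x in \<mu>. x \<notin> S" by (rule AE_not_in)
  then have V_0: "AE x in \<mu>. V x \<noteq> 0"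
    by eventually_elim (use pS in \<open>metis V_def right_minus_eq\<close>)
  \<comment> \<open>The only use of optimality. The images \<open>p x + s n *\<^sub>R y n x\<close> lie in the competitor, so they
    bound its cost from above.\<close>
  have quotient_nonneg: "0 \<le> (\<integral>x. (\<phi> (norm (V x - s n *\<^sub>R y n x)) - \<phi> (norm (V x))) / s n \<partial>\<mu>)" for n
  proof -
    define F where "F z = z + (s n * c) *\<^sub>R \<xi> z" for z
    let ?W = "F ` T n"
    have "(\<lambda>z. z + (s n / (2 * L * l)) *\<^sub>R \<xi> z) ` T n \<in> admissible l"
    proof (rule lipschitz_perturbation_admissible)
      show "T n \<noteq> {}" using q(1) by blast
      show "hausdorff1 (T n) + ennreal (s n / 2) \<le> ennreal l" using T(6) S'(3) by (rule order_trans)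
    qed (use T s \<xi> \<open>0 < l\<close> in auto)
    then have W: "?W \<in> admissible l" by (simp add: F_def[abs_def] c_def)
    have infdist_le: "infdist x ?W \<le> norm (V x - s n *\<^sub>R y n x)" for x
    proof (cases "p x \<in> T n")
      case True
      then have "infdist x ?W \<le> dist x (F (p x))" by (intro infdist_le) auto
      also have "\<dots> = norm (V x - s n *\<^sub>R y n x)"
        using True by (simp add: F_def V_def y_def dist_norm algebra_simps)
      finally show ?thesis .
    next
      case False
      have "infdist x ?W \<le> dist x (F (q n))" using q(1) by (intro infdist_le) auto
      also have "\<dots> = norm (V x - s n *\<^sub>R y n x)"
        using False s(1)[of n] by (simp add: F_def V_def y_def dist_norm algebra_simps)
      finally show ?thesis .
    qed
    have norm_le: "AE x in \<mu>. norm (V x - s n *\<^sub>R y n x) \<le> R + (2 + c)"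
      using V_R
    proof eventually_elim
      case (elim x)
      have "s n * norm (y n x) \<le> 1 * (2 + c)"
        using s(2)[of n] y_bound[of n x] s(1)[of n] \<open>0 < c\<close> by (intro mult_mono) auto
      then show ?case
        using elim norm_triangle_ineq4[of "V x" "s n *\<^sub>R y n x"] s(1)[of n] by simp
    qed
    \<comment> \<open>Integrability is needed because \<open>objective\<close> and the integrals below default to \<open>0\<close> without it.\<close>
    have int_moved: "integrable \<mu> (\<lambda>x. \<phi> (norm (V x - s n *\<^sub>R y n x)))"
      using norm_le V_meas y_meas by (intro integrable_bounded_cost[OF _ \<phi>(2,1,3)]) (auto intro: finite_measure_axioms)
    have int_S: "integrable \<mu> (\<lambda>x. \<phi> (norm (V x)))"
      using V_R V_meas by (intro integrable_bounded_cost[OF _ \<phi>(2,1,3)]) (auto intro: finite_measure_axioms)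
    have "(\<lambda>x. infdist x ?W) \<in> borel_measurable borel"
      by (intro borel_measurable_continuous_onI continuous_intros)
    then have int_W: "integrable \<mu> (\<lambda>x. \<phi> (infdist x ?W))"
    proof (intro integrable_bounded_cost[OF _ \<phi>(2,1,3)])
      show "AE x in \<mu>. infdist x ?W \<le> R + (2 + c)"
        using norm_le by eventually_elim (rule order_trans[OF infdist_le])
    qed (auto intro: finite_measure_axioms infdist_nonneg simp: meas)
    have "(\<integral>x. \<phi> (norm (V x)) \<partial>\<mu>) = objective \<phi> \<mu> S"
      by (simp add: objective_def V_def p_dist)
    also have "\<dots> \<le> objective \<phi> \<mu> ?W" using W by (rule minimal)
    also have "\<dots> \<le> (\<integral>x. \<phi> (norm (V x - s n *\<^sub>R y n x)) \<partial>\<mu>)"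
      unfolding objective_def using int_W int_moved infdist_le
      by (intro integral_mono mono_onD[OF \<phi>(3)]) (auto simp: infdist_nonneg)
    finally show ?thesis
      using int_moved int_S s(1)[of n] by (simp add: integral_diff divide_nonneg_pos)
  qed
  have "(\<lambda>n. \<integral>x. (\<phi> (norm (V x - s n *\<^sub>R y n x)) - \<phi> (norm (V x))) / s n \<partial>\<mu>)
      \<longlonglongrightarrow> - (\<integral>x. deriv_halfline \<phi> (norm (V x)) * (sgn (V x) \<bullet> Y x) \<partial>\<mu>)"
    using V_meas V_R V_0 y_meas y_bound y_lim s(1) s(2) s(3)
    by (rule first_variation_limit[OF \<phi>(2) finite_measure_axioms])
  then have first_order: "0 \<le> - (\<integral>x. deriv_halfline \<phi> (norm (V x)) * (sgn (V x) \<bullet> Y x) \<partial>\<mu>)"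
    by (rule LIMSEQ_le_const) (use quotient_nonneg in blast)
  let ?b = "cost_gradient \<phi> p"
  let ?A = "\<integral>x. indicator {a} (p x) *\<^sub>R ?b x \<partial>\<mu>"
  have [measurable]: "?b \<in> borel_measurable borel"
    using \<phi>(2) p_borel by (rule cost_gradient_measurable)
  obtain M where M: "0 < M" "\<And>x. x \<in> msupport \<mu> \<Longrightarrow> norm (?b x) \<le> M"
    using cost_gradient_bounded_on_msupport[OF \<mu>(3) S'(1) p \<phi>(2)] by blast
  have b_M: "AE x in \<mu>. norm (?b x) \<le> M"
    using AE_in_msupport[OF \<mu>(2)] by eventually_elim (rule M(2))
  have int_b\<xi>: "integrable \<mu> (\<lambda>x. ?b x \<bullet> \<xi> (p x))"
  proof (rule integrable_const_bound)
    show "AE x in \<mu>. norm (?b x \<bullet> \<xi> (p x)) \<le> M"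
      using b_M
    proof eventually_elim
      case (elim x)
      have "\<bar>?b x \<bullet> \<xi> (p x)\<bar> \<le> norm (?b x) * norm (\<xi> (p x))" by (rule Cauchy_Schwarz_ineq2)
      also have "\<dots> \<le> M * 1" using elim \<xi>(3) M(1) by (intro mult_mono) auto
      finally show ?case by simp
    qed
    show "(\<lambda>x. ?b x \<bullet> \<xi> (p x)) \<in> borel_measurable \<mu>" unfolding meas by measurable
  qed
  have int_A: "integrable \<mu> (\<lambda>x. indicator {a} (p x) *\<^sub>R ?b x)"
  proof (rule integrable_const_bound)
    show "AE x in \<mu>. norm (indicator {a} (p x) *\<^sub>R ?b x) \<le> M"
      using b_M by eventually_elim (use M(1) in \<open>auto simp: indicator_def\<close>)
    show "(\<lambda>x. indicator {a} (p x) *\<^sub>R ?b x) \<in> borel_measurable \<mu>" unfolding meas by measurable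
  qed
  have "(\<integral>x. deriv_halfline \<phi> (norm (V x)) * (sgn (V x) \<bullet> Y x) \<partial>\<mu>)
      = (\<integral>x. c * (?b x \<bullet> \<xi> (p x)) + (indicator {a} (p x) *\<^sub>R ?b x) \<bullet> u \<partial>\<mu>)"
    by (intro Bochner_Integration.integral_cong)
       (auto simp: V_def Y_def cost_gradient_def inner_add_right distrib_left)
  also have "\<dots> = (\<integral>x. c * (?b x \<bullet> \<xi> (p x)) \<partial>\<mu>) + (\<integral>x. (indicator {a} (p x) *\<^sub>R ?b x) \<bullet> u \<partial>\<mu>)"
    using int_b\<xi> int_A by (intro Bochner_Integration.integral_add integrable_mult_right integrable_inner_left)
  also have "\<dots> = c * (\<integral>x. ?b x \<bullet> \<xi> (p x) \<partial>\<mu>) + ?A \<bullet> u"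
    using int_A by (simp only: integral_mult_right_zero integral_inner_left)
  finally have "c * (\<integral>x. ?b x \<bullet> \<xi> (p x) \<partial>\<mu>) \<le> - (?A \<bullet> u)" using first_order by simp
  also have "\<dots> \<le> norm ?A * norm u" using Cauchy_Schwarz_ineq2[of ?A u] by simp
  also have "\<dots> \<le> norm ?A" using u(2) by (simp add: mult_left_le)
  finally have "c * (\<integral>x. ?b x \<bullet> \<xi> (p x) \<partial>\<mu>) \<le> norm ?A" .
  then show ?thesis
    using \<xi>(1) \<open>0 < l\<close> by (simp add: c_def divide_le_eq mult.commute)
qed

section \<open>The barycentre field\<close>

text \<open>This is a version of the barycentre. The restriction to the support makes the integrand bounded, so the
integral over each fibre is bounded and measurable in \<open>\<sigma>\<close>, with no exceptional
fibres.\<close>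

definition fibre_gradient ::
    "(real \<Rightarrow> real) \<Rightarrow> 'a measure \<Rightarrow> ('a::euclidean_space \<Rightarrow> 'a) \<Rightarrow> ('a \<Rightarrow> 'a measure) \<Rightarrow> 'a \<Rightarrow> 'a" where
  "fibre_gradient \<phi> \<mu> p \<kappa> \<sigma> = (\<integral>x. indicator (msupport \<mu>) x *\<^sub>R cost_gradient \<phi> p x \<partial>\<kappa> \<sigma>)"

lemma AE_at_point:
  assumes "AE x in \<nu>. P x" "{a} \<in> sets \<nu>" "emeasure \<nu> {a} \<noteq> 0"
  shows "P a"
proof (rule ccontr)
  assume "\<not> P a"
  obtain N where N: "{x \<in> space \<nu>. \<not> P x} \<subseteq> N" "emeasure \<nu> N = 0" "N \<in> sets \<nu>"
    using AE_E[OF assms(1)] .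
  have "a \<in> space \<nu>" using sets.sets_into_space[OF assms(2)] by simp
  then have "{a} \<subseteq> N" using N(1) \<open>\<not> P a\<close> by auto
  then have "emeasure \<nu> {a} = 0" using emeasure_mono[OF _ N(3), of "{a}"] N(2) by simp
  then show False using assms(3) by simp
qed

lemma finite_points_measure_ge:
  assumes "finite_measure \<nu>" "0 < e" "\<And>a. a \<in> A \<Longrightarrow> {a} \<in> sets \<nu>" "\<And>a. a \<in> A \<Longrightarrow> e \<le> measure \<nu> {a}"
  shows "finite A"
proof -
  interpret finite_measure \<nu> by fact
  have "finite A \<and> card A \<le> nat \<lfloor>measure \<nu> (space \<nu>) / e\<rfloor>"
  proof (rule finite_if_finite_subsets_card_bdd)
    fix G assume G: "G \<subseteq> A" "finite G"
    have "card G * e = (\<Sum>a\<in>G. e)" by simp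
    also have "\<dots> \<le> (\<Sum>a\<in>G. measure \<nu> {a})" using G assms(4) by (intro sum_mono) auto
    also have "\<dots> = measure \<nu> G"
      using G assms(3) by (intro finite_measure_eq_sum_singleton[symmetric]) auto
    also have "\<dots> \<le> measure \<nu> (space \<nu>)" by (rule bounded_measure)
    finally show "card G \<le> nat \<lfloor>measure \<nu> (space \<nu>) / e\<rfloor>"
      using \<open>0 < e\<close> by (simp add: le_nat_floor pos_le_divide_eq)
  qed
  then show ?thesis by simp
qed

text \<open>Almost every fibre measure lives both on its fibre and on the support of \<open>\<mu>\<close>, so restricting the
integrand to either set has no effect.\<close>

lemma barycentre_eq_fibre_gradient:
  fixes \<mu> :: "'a::euclidean_space measure"
  assumes \<mu>: "sets \<mu> = sets borel" and p: "p \<in> borel_measurable borel"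
    and \<kappa>: "disintegration \<mu> p \<kappa>" and \<phi>: "C1_halfline \<phi>"
  shows "AE \<sigma> in distr \<mu> borel p. barycentre \<phi> p \<kappa> \<sigma> = fibre_gradient \<phi> \<mu> p \<kappa> \<sigma>"
proof -
  have [measurable]: "msupport \<mu> \<in> sets borel" using closed_msupport by (rule borel_closed)
  note [measurable] = p cost_gradient_measurable[OF \<phi> p]
  have kernel: "\<kappa> \<in> borel \<rightarrow>\<^sub>M subprob_algebra borel"
    using \<kappa> by (rule disintegration_kernel)
  have "AE \<sigma> in distr \<mu> borel p. AE x in \<kappa> \<sigma>. x \<notin> - msupport \<mu>"
    using \<mu> p \<kappa> emeasure_compl_msupport[OF \<mu>] by (intro AE_disintegration) auto
  moreover have "AE \<sigma> in distr \<mu> borel p. AE x in \<kappa> \<sigma>. x \<in> p -` {\<sigma>}"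
    using \<kappa> by (simp add: disintegration_def)
  ultimately show ?thesis
  proof eventually_elim
    case (elim \<sigma>)
    have meas: "borel_measurable (\<kappa> \<sigma>) = (borel_measurable borel :: ('a \<Rightarrow> 'a) set)"
      using subprob_measurableD(2)[OF kernel] by (intro measurable_cong_sets) auto
    have fibre: "p -` {\<sigma>} \<in> sets borel" using measurable_sets[OF p, of "{\<sigma>}"] by simp
    show ?case
      unfolding barycentre_def set_lebesgue_integral_def fibre_gradient_def cost_gradient_def[symmetric]
    proof (rule integral_cong_AE)
      show "AE x in \<kappa> \<sigma>. indicator (p -` {\<sigma>}) x *\<^sub>R cost_gradient \<phi> p x
          = indicator (msupport \<mu>) x *\<^sub>R cost_gradient \<phi> p x"
        using elim by eventually_elim auto
      show "(\<lambda>x. indicator (p -` {\<sigma>}) x *\<^sub>R cost_gradient \<phi> p x) \<in> borel_measurable (\<kappa> \<sigma>)"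
        unfolding meas using fibre by measurable
      show "(\<lambda>x. indicator (msupport \<mu>) x *\<^sub>R cost_gradient \<phi> p x) \<in> borel_measurable (\<kappa> \<sigma>)"
        unfolding meas by measurable
    qed
  qed
qed

lemma fibre_gradient_measurable:
  fixes \<mu> :: "'a::euclidean_space measure"
  assumes p: "p \<in> borel_measurable borel" and \<kappa>: "disintegration \<mu> p \<kappa>" and \<phi>: "C1_halfline \<phi>"
  shows "fibre_gradient \<phi> \<mu> p \<kappa> \<in> borel_measurable borel"
proof -
  have [measurable]: "msupport \<mu> \<in> sets borel" using closed_msupport by (rule borel_closed)
  note [measurable] = cost_gradient_measurable[OF \<phi> p]
  have [measurable]: "\<kappa> \<in> borel \<rightarrow>\<^sub>M subprob_algebra borel"
    using \<kappa> by (rule disintegration_kernel)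
  show ?thesis unfolding fibre_gradient_def[abs_def] by measurable
qed

lemma fibre_gradient_bounded:
  fixes \<mu> :: "'a::euclidean_space measure"
  assumes p: "p \<in> borel_measurable borel" and \<kappa>: "disintegration \<mu> p \<kappa>" and \<phi>: "C1_halfline \<phi>"
    and M: "\<And>x. x \<in> msupport \<mu> \<Longrightarrow> norm (cost_gradient \<phi> p x) \<le> M" "0 \<le> M"
  shows "norm (fibre_gradient \<phi> \<mu> p \<kappa> \<sigma>) \<le> M"
proof -
  interpret \<kappa>: prob_space "\<kappa> \<sigma>" using \<kappa> by (rule disintegration_prob_space)
  have bound: "norm (indicator (msupport \<mu>) x *\<^sub>R cost_gradient \<phi> p x) \<le> M" for x
    using M by (auto simp: indicator_def)
  have "norm (fibre_gradient \<phi> \<mu> p \<kappa> \<sigma>) \<le> (\<integral>x. M \<partial>\<kappa> \<sigma>)"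
    unfolding fibre_gradient_def using bound M(2)
    by (intro Bochner_Integration.integral_norm_bound[THEN order_trans] integral_mono_AE') auto
  then show ?thesis using \<kappa>.prob_space by simp
qed

lemma weighted_fibre_gradient:
  fixes \<mu> :: "'a::euclidean_space measure" and h :: "'a \<Rightarrow> real"
  assumes \<mu>: "prob_space \<mu>" "sets \<mu> = sets borel"
    and p: "p \<in> borel_measurable borel" and \<kappa>: "disintegration \<mu> p \<kappa>" and \<phi>: "C1_halfline \<phi>"
    and M: "\<And>x. x \<in> msupport \<mu> \<Longrightarrow> norm (cost_gradient \<phi> p x) \<le> M" "0 \<le> M"
    and h: "h \<in> borel_measurable borel" "\<And>x. \<bar>h x\<bar> \<le> 1" and "i \<in> Basis"
  shows "(\<integral>\<sigma>. h \<sigma> * (fibre_gradient \<phi> \<mu> p \<kappa> \<sigma> \<bullet> i) \<partial>distr \<mu> borel p)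
    = (\<integral>x. h (p x) * (cost_gradient \<phi> p x \<bullet> i) \<partial>\<mu>)"
proof -
  let ?g = "\<lambda>x. indicator (msupport \<mu>) x *\<^sub>R cost_gradient \<phi> p x"
  have [measurable]: "msupport \<mu> \<in> sets borel" using closed_msupport by (rule borel_closed)
  note [measurable] = p h(1) cost_gradient_measurable[OF \<phi> p]
  have kernel: "\<kappa> \<in> borel \<rightarrow>\<^sub>M subprob_algebra borel"
    using \<kappa> by (rule disintegration_kernel)
  have g_M: "norm (?g x) \<le> M" for x using M by (auto simp: indicator_def)
  have "fibre_gradient \<phi> \<mu> p \<kappa> \<sigma> \<bullet> i = (\<integral>x. ?g x \<bullet> i \<partial>\<kappa> \<sigma>)" for \<sigma>
  proof -
    interpret \<kappa>: prob_space "\<kappa> \<sigma>" using \<kappa> by (rule disintegration_prob_space)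
    have meas: "borel_measurable (\<kappa> \<sigma>) = (borel_measurable borel :: ('a \<Rightarrow> 'a) set)"
      using subprob_measurableD(2)[OF kernel] by (intro measurable_cong_sets) auto
    have "integrable (\<kappa> \<sigma>) ?g"
    proof (rule \<kappa>.integrable_const_bound)
      show "AE x in \<kappa> \<sigma>. norm (?g x) \<le> M" using g_M by simp
      show "?g \<in> borel_measurable (\<kappa> \<sigma>)" unfolding meas by measurable
    qed
    then show ?thesis unfolding fibre_gradient_def by (rule integral_inner_left[symmetric])
  qed
  then have "(\<integral>\<sigma>. h \<sigma> * (fibre_gradient \<phi> \<mu> p \<kappa> \<sigma> \<bullet> i) \<partial>distr \<mu> borel p)
      = (\<integral>\<sigma>. h \<sigma> * (\<integral>x. ?g x \<bullet> i \<partial>\<kappa> \<sigma>) \<partial>distr \<mu> borel p)"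
    by simp
  also have "\<dots> = (\<integral>x. h (p x) * (?g x \<bullet> i) \<partial>\<mu>)"
  proof (rule integral_fibre_weighted[OF \<mu> p \<kappa> _ _ h])
    show "(\<lambda>x. ?g x \<bullet> i) \<in> borel_measurable borel" by measurable
    show "\<bar>?g x \<bullet> i\<bar> \<le> M" for x
      using Basis_le_norm[OF \<open>i \<in> Basis\<close>, of "?g x"] g_M[of x] by linarith
  qed
  also have "\<dots> = (\<integral>x. h (p x) * (cost_gradient \<phi> p x \<bullet> i) \<partial>\<mu>)"
  proof (rule integral_cong_AE)
    have meas: "borel_measurable \<mu> = (borel_measurable borel :: ('a \<Rightarrow> real) set)"
      using \<mu>(2) by (rule measurable_cong_sets) simp
    show "(\<lambda>x. h (p x) * (?g x \<bullet> i)) \<in> borel_measurable \<mu>" unfolding meas by measurable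
    show "(\<lambda>x. h (p x) * (cost_gradient \<phi> p x \<bullet> i)) \<in> borel_measurable \<mu>" unfolding meas by measurable
    show "AE x in \<mu>. h (p x) * (?g x \<bullet> i) = h (p x) * (cost_gradient \<phi> p x \<bullet> i)"
      using AE_in_msupport[OF \<mu>(2)] by eventually_elim simp
  qed
  finally show ?thesis .
qed

text \<open>The barycentre is determined only up to null sets. If \<open>a\<close> has positive mass, its value
at \<open>a\<close> is forced; if \<open>a\<close> has mass zero, both sides vanish.\<close>

lemma norm_barycentre_atom:
  fixes \<mu> :: "'a::euclidean_space measure"
  assumes \<mu>: "prob_space \<mu>" "sets \<mu> = sets borel"
    and p: "p \<in> borel_measurable borel" and \<kappa>: "disintegration \<mu> p \<kappa>" and \<phi>: "C1_halfline \<phi>"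
    and M: "\<And>x. x \<in> msupport \<mu> \<Longrightarrow> norm (cost_gradient \<phi> p x) \<le> M" "0 \<le> M"
  shows "norm (barycentre \<phi> p \<kappa> a) * measure (distr \<mu> borel p) {a}
    = norm (\<integral>x. indicator {a} (p x) *\<^sub>R cost_gradient \<phi> p x \<partial>\<mu>)"
proof -
  let ?\<nu> = "distr \<mu> borel p" and ?B = "fibre_gradient \<phi> \<mu> p \<kappa>"
  interpret prob_space \<mu> by fact
  have meas: "borel_measurable \<mu> = (borel_measurable borel :: ('a \<Rightarrow> 'a) set)"
    using \<mu>(2) by (rule measurable_cong_sets) simp
  note [measurable] = p cost_gradient_measurable[OF \<phi> p]
  have int: "integrable \<mu> (\<lambda>x. indicator {a} (p x) *\<^sub>R cost_gradient \<phi> p x)"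
  proof (rule integrable_const_bound)
    show "AE x in \<mu>. norm (indicator {a} (p x) *\<^sub>R cost_gradient \<phi> p x) \<le> M"
      using AE_in_msupport[OF \<mu>(2)] by eventually_elim (use M in \<open>auto simp: indicator_def\<close>)
    show "(\<lambda>x. indicator {a} (p x) *\<^sub>R cost_gradient \<phi> p x) \<in> borel_measurable \<mu>"
      unfolding meas by measurable
  qed
  have "(\<integral>x. indicator {a} (p x) *\<^sub>R cost_gradient \<phi> p x \<partial>\<mu>) = measure ?\<nu> {a} *\<^sub>R ?B a"
  proof (rule euclidean_eqI)
    fix i :: 'a assume i: "i \<in> Basis"
    have "(\<integral>x. indicator {a} (p x) *\<^sub>R cost_gradient \<phi> p x \<partial>\<mu>) \<bullet> i
        = (\<integral>x. indicator {a} (p x) * (cost_gradient \<phi> p x \<bullet> i) \<partial>\<mu>)"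
      using int by (simp flip: integral_inner_left)
    also have "\<dots> = (\<integral>\<sigma>. indicator {a} \<sigma> * (?B \<sigma> \<bullet> i) \<partial>?\<nu>)"
      using M i by (intro weighted_fibre_gradient[OF \<mu> p \<kappa> \<phi>, symmetric]) (auto simp: indicator_def)
    also have "\<dots> = (\<integral>\<sigma>. indicator {a} \<sigma> * (?B a \<bullet> i) \<partial>?\<nu>)"
      by (intro Bochner_Integration.integral_cong) (auto simp: indicator_def)
    also have "\<dots> = measure ?\<nu> {a} * (?B a \<bullet> i)" by simp
    finally show "(\<integral>x. indicator {a} (p x) *\<^sub>R cost_gradient \<phi> p x \<partial>\<mu>) \<bullet> i = (measure ?\<nu> {a} *\<^sub>R ?B a) \<bullet> i"
      by simp
  qed
  moreover have "barycentre \<phi> p \<kappa> a = ?B a" if "measure ?\<nu> {a} \<noteq> 0"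
    using that by (intro AE_at_point[OF barycentre_eq_fibre_gradient[OF \<mu>(2) p \<kappa> \<phi>]]) (auto simp: measure_def)
  ultimately show ?thesis by (cases "measure ?\<nu> {a} = 0") (auto simp: mult.commute)
qed

text \<open>Some coordinate of the barycentre field is not almost everywhere zero, and a Lipschitz function
detects it; the field \<open>\<xi>\<close> points in that coordinate direction.\<close>

lemma exists_increasing_direction:
  fixes \<mu> :: "'a::euclidean_space measure"
  assumes \<mu>: "prob_space \<mu>" "sets \<mu> = sets borel"
    and p: "p \<in> borel_measurable borel" and \<kappa>: "disintegration \<mu> p \<kappa>" and \<phi>: "C1_halfline \<phi>"
    and M: "\<And>x. x \<in> msupport \<mu> \<Longrightarrow> norm (cost_gradient \<phi> p x) \<le> M" "0 \<le> M"
    and nonzero: "\<not> (AE \<sigma> in distr \<mu> borel p. barycentre \<phi> p \<kappa> \<sigma> = 0)"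
  obtains \<xi> :: "'a \<Rightarrow> 'a" and L where "0 < L" "L-lipschitz_on UNIV \<xi>" "\<And>z. norm (\<xi> z) \<le> 1"
    "0 < (\<integral>x. cost_gradient \<phi> p x \<bullet> \<xi> (p x) \<partial>\<mu>)"
proof -
  let ?\<nu> = "distr \<mu> borel p" and ?B = "fibre_gradient \<phi> \<mu> p \<kappa>"
  interpret prob_space \<mu> by fact
  have p': "p \<in> measurable \<mu> borel" using p \<mu>(2) by (simp cong: measurable_cong_sets)
  interpret \<nu>: prob_space ?\<nu> using p' by (rule prob_space_distr)
  note [measurable] = fibre_gradient_measurable[OF p \<kappa> \<phi>]
  have "\<exists>i\<in>Basis. \<not> (AE \<sigma> in ?\<nu>. ?B \<sigma> \<bullet> i = 0)"
  proof (rule ccontr)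
    assume "\<not> ?thesis"
    then have "AE \<sigma> in ?\<nu>. \<forall>i\<in>Basis. ?B \<sigma> \<bullet> i = 0" by (simp add: AE_finite_all)
    with barycentre_eq_fibre_gradient[OF \<mu>(2) p \<kappa> \<phi>]
    have "AE \<sigma> in ?\<nu>. barycentre \<phi> p \<kappa> \<sigma> = 0"
      by eventually_elim (simp add: euclidean_all_zero_iff)
    then show False using nonzero by blast
  qed
  then obtain i where i: "i \<in> Basis" "\<not> (AE \<sigma> in ?\<nu>. ?B \<sigma> \<bullet> i = 0)" by blast
  have "integrable ?\<nu> (\<lambda>\<sigma>. ?B \<sigma> \<bullet> i)"
  proof (rule \<nu>.integrable_const_bound)
    have "\<bar>?B \<sigma> \<bullet> i\<bar> \<le> M" for \<sigma>
      using Basis_le_norm[OF i(1), of "?B \<sigma>"] fibre_gradient_bounded[OF p \<kappa> \<phi> M, of \<sigma>] by linarith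
    then show "AE \<sigma> in ?\<nu>. norm (?B \<sigma> \<bullet> i) \<le> M" by simp
    show "(\<lambda>\<sigma>. ?B \<sigma> \<bullet> i) \<in> borel_measurable ?\<nu>" by measurable
  qed
  from exists_lipschitz_test_function[OF sets_distr this i(2)]
  obtain h L where h: "0 < L" "L-lipschitz_on UNIV h" "\<And>x. \<bar>h x\<bar> \<le> 1"
    "0 < (\<integral>\<sigma>. h \<sigma> * (?B \<sigma> \<bullet> i) \<partial>?\<nu>)" by blast
  have h_borel: "h \<in> borel_measurable borel"
    using lipschitz_on_continuous_on[OF h(2)] by (rule borel_measurable_continuous_onI)
  show thesis
  proof (rule that[OF h(1), of "\<lambda>z. h z *\<^sub>R i"])
    show "L-lipschitz_on UNIV (\<lambda>z. h z *\<^sub>R i)"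
      using h(2) i(1) by (simp add: lipschitz_on_def dist_norm flip: scaleR_left_diff_distrib)
    show "norm (h z *\<^sub>R i) \<le> 1" for z using h(3) i(1) by simp
    have "(\<integral>x. cost_gradient \<phi> p x \<bullet> (h (p x) *\<^sub>R i) \<partial>\<mu>) = (\<integral>\<sigma>. h \<sigma> * (?B \<sigma> \<bullet> i) \<partial>?\<nu>)"
      using weighted_fibre_gradient[OF \<mu> p \<kappa> \<phi> M h_borel h(3) i(1)] by simp
    then show "0 < (\<integral>x. cost_gradient \<phi> p x \<bullet> (h (p x) *\<^sub>R i) \<partial>\<mu>)" using h(4) by simp
  qed
qed

theorem theorem1p3:
  fixes \<mu> :: "'a::euclidean_space measure"
    and \<phi> :: "real \<Rightarrow> real"
    and l :: real
    and S :: "'a set"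
    and p :: "'a \<Rightarrow> 'a"
    and \<kappa> :: "'a \<Rightarrow> 'a measure"
    and \<nu> :: "'a measure"
  assumes "DIM('a) \<ge> 2"
    and "prob_space \<mu>" and "sets \<mu> = sets borel" and "compact (msupport \<mu>)"
    and "\<phi> 0 = 0" and "C1_halfline \<phi>" and "mono_on {0..} \<phi>"
    and "\<And>E. E \<in> sets borel \<Longrightarrow> hausdorff1 E < \<infinity> \<Longrightarrow> emeasure \<mu> E = 0"
    and "l > 0"
    and "S \<in> admissible l"
    and "objective \<phi> \<mu> S = (INF T\<in>admissible l. objective \<phi> \<mu> T)"
    and "p \<in> closest_point_projections S"
    and "\<nu> = distr \<mu> borel p"
    and "disintegration \<mu> p \<kappa>"
  shows "(\<exists>C>0. \<forall>\<sigma>. noncut_point S \<sigma> \<longrightarrow>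
            C * (LINT \<tau>:S|\<nu>. norm (barycentre \<phi> p \<kappa> \<tau>))
              \<le> norm (barycentre \<phi> p \<kappa> \<sigma>) * measure \<nu> {\<sigma>}) \<and>
         ((LINT \<tau>:S|\<nu>. norm (barycentre \<phi> p \<kappa> \<tau>)) \<noteq> 0 \<longrightarrow>
            (\<forall>\<sigma>. noncut_point S \<sigma> \<longrightarrow> atom_of \<mu> S \<sigma>) \<and>
            finite {\<sigma>. noncut_point S \<sigma>})"
proof -
  note \<mu> = assms(2,3,4) and \<phi> = assms(5,6,7) and \<kappa> = assms(14)
  define I where "I = (LINT \<tau>:S|\<nu>. norm (barycentre \<phi> p \<kappa> \<tau>))"
  interpret prob_space \<mu> by fact
  have S: "compact S" "hausdorff1 S \<le> ennreal l" using assms(10) by (auto simp: admissible_def)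
  have p: "p \<in> borel_measurable borel" using assms(12) by (simp add: closest_point_projections_def)
  have p': "p \<in> measurable \<mu> borel" using p \<mu>(2) by (simp cong: measurable_cong_sets)
  interpret \<nu>: prob_space \<nu> unfolding assms(13) using p' by (rule prob_space_distr)
  have S_null: "emeasure \<mu> S = 0"
  proof (rule assms(8))
    show "hausdorff1 S < \<infinity>" using S(2) by (rule le_less_trans) simp
  qed (rule borel_compact[OF S(1)])
  have minimal: "objective \<phi> \<mu> S \<le> objective \<phi> \<mu> T" if "T \<in> admissible l" for T
    unfolding assms(11)
  proof (rule cINF_lower[OF _ that], rule bdd_belowI2)
    fix T :: "'a set"
    have "0 \<le> \<phi> (infdist x T)" for x
      using mono_onD[OF \<phi>(3), of 0 "infdist x T"] \<phi>(1) by (simp add: infdist_nonneg)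
    then show "0 \<le> objective \<phi> \<mu> T" unfolding objective_def by (intro Bochner_Integration.integral_nonneg) auto
  qed
  obtain M where M: "0 < M" "\<And>x. x \<in> msupport \<mu> \<Longrightarrow> norm (cost_gradient \<phi> p x) \<le> M"
    using cost_gradient_bounded_on_msupport[OF \<mu>(3) S(1) assms(12) \<phi>(2)] by blast
  have atom_eq: "norm (barycentre \<phi> p \<kappa> \<sigma>) * measure \<nu> {\<sigma>}
      = norm (\<integral>x. indicator {\<sigma>} (p x) *\<^sub>R cost_gradient \<phi> p x \<partial>\<mu>)" for \<sigma>
    unfolding assms(13) using M by (intro norm_barycentre_atom[OF \<mu>(1,2) p \<kappa> \<phi>(2)]) auto
  have I_nonneg: "0 \<le> I" unfolding I_def set_lebesgue_integral_def by (intro Bochner_Integration.integral_nonneg) auto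
  have main: "\<exists>C>0. \<forall>\<sigma>. noncut_point S \<sigma> \<longrightarrow> C * I \<le> norm (barycentre \<phi> p \<kappa> \<sigma>) * measure \<nu> {\<sigma>}"
  \<comment> \<open>A single point cannot be cut; there all the mass is projected to it and equality holds with
    \<open>C = 1\<close>.\<close>
  proof (cases "I = 0 \<or> (\<exists>a. S = {a})")
    case True
    have "I = norm (barycentre \<phi> p \<kappa> a) * measure \<nu> {a}" if "S = {a}" for a
    proof -
      have "I = (\<integral>\<tau>. indicator {a} \<tau> * norm (barycentre \<phi> p \<kappa> a) \<partial>\<nu>)"
        unfolding I_def set_lebesgue_integral_def that
        by (intro Bochner_Integration.integral_cong) (auto simp: indicator_def)
      then show ?thesis by (simp add: assms(13))
    qed
    then show ?thesis
      using True by (intro exI[of _ 1]) (auto simp: noncut_point_def)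
  next
    case False
    \<comment> \<open>The integral of a function that vanishes almost everywhere is \<open>0\<close>, so \<open>I \<noteq> 0\<close> excludes this.\<close>
    have "\<not> (AE \<sigma> in \<nu>. barycentre \<phi> p \<kappa> \<sigma> = 0)"
    proof
      assume "AE \<sigma> in \<nu>. barycentre \<phi> p \<kappa> \<sigma> = 0"
      then have "AE \<sigma> in \<nu>. indicator S \<sigma> *\<^sub>R norm (barycentre \<phi> p \<kappa> \<sigma>) = 0"
        by eventually_elim simp
      then have "I = 0" unfolding I_def set_lebesgue_integral_def by (rule integral_eq_zero_AE)
      then show False using False by blast
    qed
    then obtain \<xi> :: "'a \<Rightarrow> 'a" and L where \<xi>: "0 < L" "L-lipschitz_on UNIV \<xi>" "\<And>z. norm (\<xi> z) \<le> 1"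
      and pos: "0 < (\<integral>x. cost_gradient \<phi> p x \<bullet> \<xi> (p x) \<partial>\<mu>)" (is "0 < ?J")
      unfolding assms(13)
      using exists_increasing_direction[OF \<mu>(1,2) p \<kappa> \<phi>(2) M(2) less_imp_le[OF M(1)]] by blast
    have "0 < I" using I_nonneg False by simp
    show ?thesis
    proof (intro exI[of _ "?J / (2 * L * l * I)"] conjI allI impI)
      show "0 < ?J / (2 * L * l * I)" using pos \<xi>(1) assms(9) \<open>0 < I\<close> by simp
      fix \<sigma> assume \<sigma>: "noncut_point S \<sigma>"
      have "?J \<le> 2 * L * l * norm (\<integral>x. indicator {\<sigma>} (p x) *\<^sub>R cost_gradient \<phi> p x \<partial>\<mu>)"
        using noncut_point_variation[OF \<mu> \<phi> S_null assms(9,10) minimal assms(12) \<sigma> _ \<xi>] False by blast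
      then show "?J / (2 * L * l * I) * I \<le> norm (barycentre \<phi> p \<kappa> \<sigma>) * measure \<nu> {\<sigma>}"
        unfolding atom_eq using \<xi>(1) assms(9) \<open>0 < I\<close> by (simp add: divide_le_eq mult.commute)
    qed
  qed
  then obtain C where C: "0 < C"
    "\<And>\<sigma>. noncut_point S \<sigma> \<Longrightarrow> C * I \<le> norm (barycentre \<phi> p \<kappa> \<sigma>) * measure \<nu> {\<sigma>}" by blast
  have "(\<forall>\<sigma>. noncut_point S \<sigma> \<longrightarrow> atom_of \<mu> S \<sigma>) \<and> finite {\<sigma>. noncut_point S \<sigma>}" if "I \<noteq> 0"
  proof -
    have "0 < C * I" using C(1) I_nonneg that by simp
    have mass: "C * I / M \<le> measure \<nu> {\<sigma>}" if \<sigma>: "noncut_point S \<sigma>" for \<sigma>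
    proof -
      have "measure \<nu> {\<sigma>} \<noteq> 0" using C(2)[OF \<sigma>] \<open>0 < C * I\<close> by auto
      then have "barycentre \<phi> p \<kappa> \<sigma> = fibre_gradient \<phi> \<mu> p \<kappa> \<sigma>"
        unfolding assms(13)
        by (intro AE_at_point[OF barycentre_eq_fibre_gradient[OF \<mu>(2) p \<kappa> \<phi>(2)]]) (auto simp: measure_def)
      then have "norm (barycentre \<phi> p \<kappa> \<sigma>) \<le> M"
        using fibre_gradient_bounded[OF p \<kappa> \<phi>(2) M(2)] M(1) by simp
      then have "norm (barycentre \<phi> p \<kappa> \<sigma>) * measure \<nu> {\<sigma>} \<le> M * measure \<nu> {\<sigma>}"
        by (intro mult_right_mono) auto
      then show ?thesis using C(2)[OF \<sigma>] M(1) by (simp add: divide_le_eq mult.commute)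
    qed
    have "atom_of \<mu> S \<sigma>" if \<sigma>: "noncut_point S \<sigma>" for \<sigma>
    proof -
      let ?A = "{x. infdist x S = dist x \<sigma>}"
      have "0 < C * I / M" using \<open>0 < C * I\<close> M(1) by simp
      also have "\<dots> \<le> measure \<nu> {\<sigma>}" using \<sigma> by (rule mass)
      also have "\<dots> = measure \<mu> (p -` {\<sigma>})"
        using p' sets_eq_imp_space_eq[OF \<mu>(2)] by (simp add: assms(13) measure_distr)
      also have "\<dots> \<le> measure \<mu> ?A"
      proof (rule finite_measure_mono)
        show "p -` {\<sigma>} \<subseteq> ?A" using assms(12) by (auto simp: closest_point_projections_def)
        have "closed ?A" by (intro closed_Collect_eq continuous_intros)
        then show "?A \<in> events" using \<mu>(2) by simp
      qed
      finally show ?thesis using \<sigma> by (simp add: atom_of_def noncut_point_def)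
    qed
    moreover have "finite {\<sigma>. noncut_point S \<sigma>}"
    proof (rule finite_points_measure_ge[of \<nu> "C * I / M"])
      show "finite_measure \<nu>" by unfold_locales
    qed (use mass \<open>0 < C * I\<close> M(1) in \<open>auto simp: assms(13)\<close>)
    ultimately show ?thesis by blast
  qed
  then show ?thesis using main unfolding I_def by blast
qed

end
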